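(* Let $\mathcal{G}^s=(\mathcal{V}^s,\mathcal{E}^s)$ be a summary causal graph (SCG), let $X,Y\in\mathcal{V}^s$ be distinct and let $\gamma\ge 0$. Suppose that either $X \notin \mathrm{Anc}(Y,\mathcal{G}^s)$, or $X \in \mathrm{Anc}(Y,\mathcal{G}^s)$ and none of the following holds: 1. $\gamma \neq 0$ and $Cycles^>(X, \mathcal{G}^s\backslash \{Y\}) \neq \emptyset$; or 2. there exists a $\sigma$-active backdoor path $\pi^s = \langle V^1=X, \cdots, V^n=Y\rangle$ from $X$ to $Y$ in $\mathcal{G}^s$ such that $\{V^2, \cdots, V^{n-1}\}\subseteq \mathrm{Desc}(X, \mathcal{G}^s)$ and one of the following holds: (a) $n > 2$; or (b) $n=2$ and $\gamma\neq 1$; or (c) $n=2$, $\gamma = 1$ and $Cycles(Y, \mathcal{G}^s)\backslash\{X\leftrightarrows Y\} \neq \emptyset$. Then the set $$\mathcal{A}'_{\gamma} = \{ V_{t'}\in \mathcal{A}_{\gamma} \mid V \in \mathrm{Anc}(X, \mathcal{G}^s) \cup \mathrm{Anc}(Y, \mathcal{G}^s)\},$$ where $$\mathcal{A}_{\gamma} = \{ (Z_{t-\gamma-\ell})_{1\leq \ell \leq \gamma_{\max}} \mid Z \in \mathrm{Desc}(X, \mathcal{G}^{s})\}\cup \{(Z_{t-\gamma-\ell})_{0\leq \ell \leq \gamma_{\max}} \mid Z \in \mathcal{V}^s\backslash \mathrm{Desc}(X, \mathcal{G}^s) \},$$ is a valid adjustment set for the total effect $P(y_t\mid do(x_{t-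\gamma}))$.
   Context: Let $\mathcal{V}$ be a finite set of $p$ observed time series and $\mathcal{V}^f=\{\mathcal{V}_{t-\ell}\mid \ell\in\mathbb{Z}\}$ the set of their temporal instances ($X_{t-\ell}$ is the variable of series $X$ at time $t-\ell$). **Full-time causal graph (FTCG).** The series are generated by an unknown dynamic structural causal model (DSCM; a structural causal model in the sense of Pearl over $\mathcal{V}^f$). Its FTCG $\mathcal{G}^f=(\mathcal{V}^f,\mathcal{E}^f)$ has an edge $X_{t-\gamma}\to Y_t$ iff $X$ directly causes $Y$ at time $t$ with time lag $\gamma$, where $\gamma>0$ if $X=Y$ and $\gamma\ge 0$ if $X\neq Y$. FTCGs are acyclic (instantaneous edges, of lag $0$, are allowed). The DSCM also defines a joint distribution $P$ over $\mathcal{V}^f$, assumed positive, which decomposes recursively along the FTCG as in Bayesian networks. **Standing assumptions.** Causal sufficiency: there is no hidden common cause between any two observed variables. Consistency throughout time: all causal relationships in the FTCG remain constant in direction and magnitude throughout time (so the edge set is invariant under time shift); edges have lag at most a fixed maximal lag $\gamma_{\max}$. **Summary causal graph (SCG).** The SCG $\mathcal{G}^s=(\mathcal{V}^s,\mathcal{E}^s)$ derived from $\mathcal{G}^f$ has $\mathcal{V}^s=\mathcal{V}$, and $X\to Y\in\mathcal{E}^s$ iff there is at least one lag $0\le\ell\le\gamma_{\max}$ with $X_{t-\ell}\to Y_t\in\mathcal{E}^f$. An SCG is a directed graph that may contain directed cycles and self-loops. $X\leftrightarrows Y$ means that both $X\to Y$ and $Y\to X$ are in $\mathcal{E}^s$.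 **Candidate FTCGs.** $\mathcal{C}(\mathcal{G}^s)$ is the set of all FTCGs (acyclic, satisfying causal sufficiency and consistency throughout time, with maximal lag $\gamma_{\max}$) from which $\mathcal{G}^s$ can be derived. **Total effect and adjustment.** $P(y_t\mid do(x_{t-\gamma}))$ denotes $P(Y_t=y_t\mid do(X_{t-\gamma}=x_{t-\gamma}))$, the distribution of $Y_t$ under Pearl's intervention on the single variable $X_{t-\gamma}$. A set of variables $\mathcal{Z}$ is a valid adjustment set if $P(y_t \mid do(x_{t-\gamma})) = \sum_\mathbf{z} P(y_t\mid x_{t-\gamma}, \mathbf{z}) P(\mathbf{z})$ (validity being required for every candidate FTCG, since the true one is unknown). **Graph notions in an SCG.** $\mathrm{Anc}(V,\mathcal{G})$ and $\mathrm{Desc}(V,\mathcal{G})$ are the ancestors and descendants of $V$ (via directed paths; $V$ is its own ancestor and descendant). $\mathcal{G}\backslash\{Y\}$ is $\mathcal{G}$ with vertex $Y$ and its incident edges removed. A path is a sequence of distinct vertices in which successive vertices are adjacent; each successive pair is linked by $\to$, $\leftarrow$ or $\leftrightarrows$ (the latter when both directed edges are present). A directed cycle is formed by a directed path from $V$ to $W$ together with a directed path from $W$ to $V$; a self-loop is also a directed cycle. $Cycles(V,\mathcal{G})$ is the set of all directed cycles containing $V$, and $Cycles^>(V,\mathcal{G})$ the subset of those with at least two different vertices (i.e. excluding self-loops). $Cycles(Y,\mathcal{G}^s)\backslash\{X\leftrightarrows Y\}$ is the set of directed cycles containing $Y$ other than the 2-cycle between $X$ and $Y$. A backdoor path between $X$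 and $Y$ in $\mathcal{G}^s$ is a path between $X$ and $Y$ that starts with $X\leftarrow$ or $X\leftrightarrows$. A path in $\mathcal{G}^s$ is $\sigma$-blocked (by the empty set) if there is a vertex $Z$ such that $\to Z\leftarrow$ is on the path (the patterns $\leftrightarrows Z\leftarrow$, $\to Z\leftrightarrows$, $\leftrightarrows Z\leftrightarrows$ do not count); otherwise it is $\sigma$-active. In particular $X\leftrightarrows Y$ and $X\leftarrow Y$ are the only $\sigma$-active backdoor paths with $n=2$ vertices. *)

theory Defs
  imports "HOL-Probability.Probability" "Graph_Theory.Pair_Digraph"
begin

section \<open>Graph notions\<close>

definition Anc :: "'v \<Rightarrow> ('v, 'b) pre_digraph \<Rightarrow> 'v set" where
  "Anc v G = {u. u \<rightarrow>\<^sup>*\<^bsub>G\<^esub> v}"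

definition Desc :: "'v \<Rightarrow> ('v, 'b) pre_digraph \<Rightarrow> 'v set" where
  "Desc v G = {u. v \<rightarrow>\<^sup>*\<^bsub>G\<^esub> u}"

text \<open>A directed cycle is represented by its set of arcs, so that its presentations with different
  base points are identified.  The two directed paths that form a cycle may share
  inner vertices.\<close>

definition directed_cycles :: "('v, 'b) pre_digraph \<Rightarrow> 'b set set" where
  "directed_cycles G =
     {{e} | e. e \<in> arcs G \<and> tail G e = head G e} \<union>
     {set p \<union> set q | p q. \<exists>v w. v \<noteq> w \<and> pre_digraph.apath G v p w \<and> pre_digraph.apath G w q v}"

definition Cycles :: "'v \<Rightarrow> ('v, 'b) pre_digraph \<Rightarrow> 'b set set" where
  "Cycles v G = {C \<in> directed_cycles G. v \<in> tail G ` C}"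

definition Cycles_gt :: "'v \<Rightarrow> ('v, 'b) pre_digraph \<Rightarrow> 'b set set" where
  "Cycles_gt v G = {C \<in> Cycles v G. 2 \<le> card (tail G ` C)}"

text \<open>Paths that ignore the direction of arcs are lists of vertices: each pair of successive vertices
  is linked in exactly one of the three ways \<open>\<rightarrow>\<close>, \<open>\<leftarrow>\<close>, \<open>\<leftrightarrows>\<close>, which is determined by the graph.\<close>

definition path_between :: "'v pair_pre_digraph \<Rightarrow> 'v \<Rightarrow> 'v list \<Rightarrow> 'v \<Rightarrow> bool" where
  "path_between G x \<pi> y \<longleftrightarrow>
     \<pi> \<noteq> [] \<and> hd \<pi> = x \<and> last \<pi> = y \<and> distinct \<pi> \<and> set \<pi> \<subseteq> pverts G \<and>
     (\<forall>i. Suc i < length \<pi> \<longrightarrow>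
        (\<pi> ! i, \<pi> ! Suc i) \<in> parcs G \<or> (\<pi> ! Suc i, \<pi> ! i) \<in> parcs G)"

definition backdoor_path :: "'v pair_pre_digraph \<Rightarrow> 'v \<Rightarrow> 'v list \<Rightarrow> 'v \<Rightarrow> bool" where
  "backdoor_path G x \<pi> y \<longleftrightarrow>
     path_between G x \<pi> y \<and> 2 \<le> length \<pi> \<and> (\<pi> ! 1, \<pi> ! 0) \<in> parcs G"

definition only_arc :: "'v pair_pre_digraph \<Rightarrow> 'v \<Rightarrow> 'v \<Rightarrow> bool" where
  "only_arc G u v \<longleftrightarrow> (u, v) \<in> parcs G \<and> (v, u) \<notin> parcs G"

definition sigma_blocked :: "'v pair_pre_digraph \<Rightarrow> 'v list \<Rightarrow> bool" where
  "sigma_blocked G \<pi> \<longleftrightarrow>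
     (\<exists>i. Suc (Suc i) < length \<pi> \<and>
        only_arc G (\<pi> ! i) (\<pi> ! Suc i) \<and> only_arc G (\<pi> ! Suc (Suc i)) (\<pi> ! Suc i))"

abbreviation sigma_active :: "'v pair_pre_digraph \<Rightarrow> 'v list \<Rightarrow> bool" where
  "sigma_active G \<pi> \<equiv> \<not> sigma_blocked G \<pi>"

section \<open>Full-time and summary causal graphs\<close>

text \<open>The vertex \<open>(x, t)\<close> is the instance of the series \<open>x\<close> at time \<open>t\<close>.\<close>

locale ftcg = pair_wf_digraph G
  for V :: "'v set" and gmax :: nat and G :: "('v \<times> int) pair_pre_digraph" +
  assumes finite_series: "finite V"
    and verts_eq: "pverts G = V \<times> UNIV"
    and lag_nonneg: "((x, s), (y, t)) \<in> parcs G \<Longrightarrow> s \<le> t"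
    and self_lag_pos: "((x, s), (x, t)) \<in> parcs G \<Longrightarrow> s < t"
    and lag_le: "((x, s), (y, t)) \<in> parcs G \<Longrightarrow> t - s \<le> int gmax"
    and consistency: "((x, s), (y, t)) \<in> parcs G \<longleftrightarrow> ((x, s + k), (y, t + k)) \<in> parcs G"
    and acyclic_arcs: "acyclic (parcs G)"

definition summary_of :: "nat \<Rightarrow> ('v \<times> int) pair_pre_digraph \<Rightarrow> 'v pair_pre_digraph" where
  "summary_of gmax G =
     \<lparr>pverts = fst ` pverts G,
      parcs = {(x, y). \<exists>t. \<exists>l\<le>gmax. ((x, t - int l), (y, t)) \<in> parcs G}\<rparr>"

definition candidate_ftcgs :: "nat \<Rightarrow> 'v pair_pre_digraph \<Rightarrow> ('v \<times> int) pair_pre_digraph set" where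
  "candidate_ftcgs gmax Gs = {G. ftcg (pverts Gs) gmax G \<and> summary_of gmax G = Gs}"

definition summary_causal_graph :: "nat \<Rightarrow> 'v pair_pre_digraph \<Rightarrow> bool" where
  "summary_causal_graph gmax Gs \<longleftrightarrow> candidate_ftcgs gmax Gs \<noteq> {}"

definition lagged_parents :: "('v \<times> int) pair_pre_digraph \<Rightarrow> 'v \<Rightarrow> ('v \<times> nat) set" where
  "lagged_parents G y = {(z, l). ((z, - int l), (y, 0)) \<in> parcs G}"

section \<open>Dynamic structural causal models\<close>

text \<open>The structural equation of \<open>(y, t)\<close> is \<open>obs (y, t) = f y pa (noise (y, t))\<close>, where \<open>pa\<close> assigns
  to every lagged parent \<open>(z, l)\<close> of \<open>y\<close> the value of \<open>(z, t - l)\<close>; \<open>f\<close> does not depend on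
  \<open>t\<close>, whereas the law of the noise may.
  The arcs of \<open>G\<close> are the direct causes: each lagged parent can change the value of \<open>f y\<close> when the
  other arguments are held fixed.  Series take values in countable domains \<open>D y\<close>.
  Causal sufficiency is the mutual independence of the noise variables.

  As time is two-sided, the equations have no initial condition, and \<open>obs\<close> is a given solution of
  them.  Assumption \<open>nonanticipating\<close> states that what happened before time \<open>t\<close> is independent of
  the noise from time \<open>t\<close> on.  In a model with a first time point this follows from \<open>noise_indep\<close>;
  here it excludes solutions that look into the future, and together with \<open>noise_indep\<close> and
  \<open>structural\<close> it gives the recursive decomposition of the joint distribution along \<open>G\<close>: each
  \<open>(y, t)\<close> is independent of its nondescendants given its parents.\<close>

locale dscm = ftcg V gmax G + prob_space M
  for V :: "'v set" and gmax :: nat and G :: "('v \<times> int) pair_pre_digraph"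
    and M :: "'w measure" +
  fixes D :: "'v \<Rightarrow> 'x set"
    and N :: "'v \<Rightarrow> 'u measure"
    and noise :: "'v \<times> int \<Rightarrow> 'w \<Rightarrow> 'u"
    and f :: "'v \<Rightarrow> ('v \<times> nat \<Rightarrow> 'x) \<Rightarrow> 'u \<Rightarrow> 'x"
    and obs :: "'v \<times> int \<Rightarrow> 'w \<Rightarrow> 'x"
  assumes countable_domain: "y \<in> V \<Longrightarrow> countable (D y)"
    and mechanism_measurable:
      "y \<in> V \<Longrightarrow> pa \<in> (\<Pi>\<^sub>E (z, l)\<in>lagged_parents G y. D z) \<Longrightarrow>
         f y pa \<in> N y \<rightarrow>\<^sub>M count_space (D y)"
    and direct_cause:
      "y \<in> V \<Longrightarrow> (z, l) \<in> lagged_parents G y \<Longrightarrow>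
         \<exists>pa \<in> \<Pi>\<^sub>E (z, l)\<in>lagged_parents G y. D z. \<exists>a \<in> D z. \<exists>u \<in> space (N y).
           f y (pa((z, l) := a)) u \<noteq> f y pa u"
    and noise_indep: "indep_vars (\<lambda>(y, t). N y) noise (V \<times> UNIV)"
    and obs_measurable: "y \<in> V \<Longrightarrow> obs (y, t) \<in> M \<rightarrow>\<^sub>M count_space (D y)"
    and structural:
      "y \<in> V \<Longrightarrow> AE \<omega> in M.
         obs (y, t) \<omega> = f y (\<lambda>(z, l)\<in>lagged_parents G y. obs (z, t - int l) \<omega>) (noise (y, t) \<omega>)"
    and nonanticipating:
      "indep_set
         (sets (vimage_algebra (space M) (\<lambda>\<omega>. \<lambda>p\<in>V \<times> {..<t}. obs p \<omega>)
                  (\<Pi>\<^sub>M (y, s)\<in>V \<times> {..<t}. count_space (D y))))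
         (sets (vimage_algebra (space M) (\<lambda>\<omega>. \<lambda>p\<in>V \<times> {t..}. noise p \<omega>)
                  (\<Pi>\<^sub>M (y, s)\<in>V \<times> {t..}. N y)))"
    and positive:
      "finite F \<Longrightarrow> F \<subseteq> V \<times> UNIV \<Longrightarrow> v \<in> (\<Pi>\<^sub>E (y, s)\<in>F. D y) \<Longrightarrow>
         0 < \<P>(\<omega> in M. \<forall>p\<in>F. obs p \<omega> = v p)"

lemma (in ftcg) lagged_parents_arc:
  assumes "(z, l) \<in> lagged_parents G y"
  shows "((z, t - int l), (y, t)) \<in> parcs G"
  using assms consistency[of z "- int l" y 0 t] by (simp add: lagged_parents_def)

lemma (in ftcg) wf_arcs_from: "wf {(p, q). (p, q) \<in> parcs G \<and> s \<le> snd q}"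
proof -
  define R where "R = {(p, q). (p, q) \<in> parcs G \<and> s \<le> snd q}"
  have acyc: "acyclic R"
    by (rule acyclic_subset[OF acyclic_arcs]) (auto simp: R_def)
  have bound: "fst p \<in> V \<and> s - int gmax \<le> snd p \<and> snd p \<le> snd q" if "(p, q) \<in> R\<^sup>+" for p q
    using that
  proof (induction rule: trancl_induct)
    case (base q)
    then have pq: "(p, q) \<in> parcs G" "s \<le> snd q" by (auto simp: R_def)
    then show ?case
      using lag_nonneg[of "fst p" "snd p" "fst q" "snd q"] lag_le[of "fst p" "snd p" "fst q" "snd q"]
        in_arcsD1[of p q] verts_eq by (cases p) auto
  next
    case (step q r)
    then have "(q, r) \<in> parcs G" by (auto simp: R_def)
    then show ?case
      using step.IH lag_nonneg[of "fst q" "snd q" "fst r" "snd r"] by auto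
  qed
  have fin: "finite {p. (p, q) \<in> R\<^sup>+}" for q
  proof (rule finite_subset)
    show "{p. (p, q) \<in> R\<^sup>+} \<subseteq> V \<times> {s - int gmax..snd q}"
      by (auto simp: mem_Times_iff dest!: bound)
    show "finite (V \<times> {s - int gmax..snd q})"
      using finite_series by simp
  qed
  have "R \<subseteq> Wellfounded.measure (\<lambda>q. card {p. (p, q) \<in> R\<^sup>+})"
  proof safe
    fix a b c d assume ab: "((a, b), (c, d)) \<in> R"
    have "{p. (p, (a, b)) \<in> R\<^sup>+} \<subset> {p. (p, (c, d)) \<in> R\<^sup>+}"
      using ab acyc by (auto simp: acyclic_def intro: trancl_into_trancl)
    then show "((a, b), (c, d)) \<in> Wellfounded.measure (\<lambda>q. card {p. (p, q) \<in> R\<^sup>+})"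
      using psubset_card_mono[OF fin] by simp
  qed
  then show ?thesis
    unfolding R_def[symmetric] by (rule wf_subset[OF wf_measure])
qed

lemma restrict_fundef_cong [fundef_cong]:
  "I = J \<Longrightarrow> (\<And>i. i \<in> J \<Longrightarrow> g i = h i) \<Longrightarrow> restrict g I = restrict h J"
  by (auto simp: restrict_def)

context dscm
begin

text \<open>The solution of the submodel for the intervention \<open>do (x, s) = a\<close>: the equation of \<open>(x, s)\<close> is
  replaced by the constant \<open>a\<close>, and all other equations from time \<open>s\<close> on are solved again with the
  same noise.  Variables before time \<open>s\<close> are not descendants of \<open>(x, s)\<close> and keep their values.\<close>

function do_obs :: "'v \<Rightarrow> int \<Rightarrow> 'x \<Rightarrow> 'w \<Rightarrow> 'v \<times> int \<Rightarrow> 'x" where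
  "do_obs x s a \<omega> (y, t) =
     (if t < s then obs (y, t) \<omega>
      else if (y, t) = (x, s) then a
      else f y (\<lambda>(z, l)\<in>lagged_parents G y. do_obs x s a \<omega> (z, t - int l)) (noise (y, t) \<omega>))"
  by pat_completeness auto
termination
proof (relation "inv_image
    (same_fst (\<lambda>_. True) (\<lambda>s. {(p, q). (p, q) \<in> parcs G \<and> s \<le> snd q}))
    (\<lambda>(x, s, a, \<omega>, p). (s, p))", goal_cases)
  case 1
  show ?case by (intro wf_inv_image wf_same_fst wf_arcs_from)
next
  case 2
  then show ?case by (auto simp: same_fst_def lagged_parents_arc)
qed

definition do_prob :: "'v \<Rightarrow> int \<Rightarrow> 'x \<Rightarrow> 'v \<Rightarrow> int \<Rightarrow> 'x \<Rightarrow> real" where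
  "do_prob x s a y t b = \<P>(\<omega> in M. do_obs x s a \<omega> (y, t) = b)"

definition valid_adjustment_set :: "'v \<Rightarrow> int \<Rightarrow> 'v \<Rightarrow> int \<Rightarrow> ('v \<times> int) set \<Rightarrow> bool" where
  "valid_adjustment_set x s y t Z \<longleftrightarrow>
     (\<forall>a\<in>D x. \<forall>b\<in>D y.
        ((\<lambda>z. \<P>(\<omega> in M. obs (y, t) \<omega> = b \<bar> obs (x, s) \<omega> = a \<and> (\<forall>p\<in>Z. obs p \<omega> = z p))
               * \<P>(\<omega> in M. \<forall>p\<in>Z. obs p \<omega> = z p))
         has_sum do_prob x s a y t b) (\<Pi>\<^sub>E (v, r)\<in>Z. D v))"

end

section \<open>The adjustment sets\<close>

definition adjustment_set ::
  "nat \<Rightarrow> 'v pair_pre_digraph \<Rightarrow> 'v \<Rightarrow> nat \<Rightarrow> int \<Rightarrow> ('v \<times> int) set" where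
  "adjustment_set gmax Gs x \<gamma> t =
     {(z, t - int \<gamma> - int l) | z l. z \<in> Desc x Gs \<and> 1 \<le> l \<and> l \<le> gmax} \<union>
     {(z, t - int \<gamma> - int l) | z l. z \<in> pverts Gs - Desc x Gs \<and> l \<le> gmax}"

definition reduced_adjustment_set ::
  "nat \<Rightarrow> 'v pair_pre_digraph \<Rightarrow> 'v \<Rightarrow> 'v \<Rightarrow> nat \<Rightarrow> int \<Rightarrow> ('v \<times> int) set" where
  "reduced_adjustment_set gmax Gs x y \<gamma> t =
     {(v, t'). (v, t') \<in> adjustment_set gmax Gs x \<gamma> t \<and> v \<in> Anc x Gs \<union> Anc y Gs}"

end

theory Submission
  imports Defs
begin

text \<open>Write \<open>s = t - \<gamma>\<close> for the time of the intervention, \<open>Z\<close> for the adjustment set and \<open>Y(a)\<close> for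
  the value of \<open>(Y, t)\<close> in the submodel for \<open>do (X, s) = a\<close>.  As the model assigns a value \<open>Y(a)\<close> to
  every outcome, the theorem is reduced to a statement about independence: since \<open>Y(a)\<close> and the
  observed \<open>(Y, t)\<close> agree when \<open>(X, s) = a\<close>, adjustment by \<open>Z\<close> is valid as soon as \<open>(X, s)\<close> and
  \<open>Y(a)\<close> are independent given \<open>Z\<close>.

  This independence is read off the noise variables.  The members of \<open>Z\<close> before time \<open>s\<close> are a window
  of length \<open>gmax\<close>, so they contain every parent before time \<open>s\<close> of a variable from time \<open>s\<close> on that
  leads to \<open>(X, s)\<close> or \<open>(Y, t)\<close>; the members of \<open>Z\<close> at time \<open>s\<close> do not descend from \<open>X\<close>.  Solving the
  structural equations backwards until a member of \<open>Z\<close> is met shows that, once \<open>Z\<close> is fixed,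
  \<^item> \<open>(X, s)\<close> is a function of the noise of a set \<open>A\<close> of variables at time \<open>s\<close>, namely those
    descendants of \<open>X\<close> in the summary graph from which \<open>(X, s)\<close> is reached by arcs of lag zero;
  \<^item> \<open>Y(a)\<close> is a function of the noise of a set \<open>B\<close> of variables from time \<open>s\<close> on, namely those from
    which \<open>(Y, t)\<close> is reached without passing through \<open>(X, s)\<close>, where at time \<open>s\<close> only descendants of
    \<open>X\<close> occur;
  \<^item> \<open>Z\<close> itself depends on the past and on the noise at time \<open>s\<close> of nondescendants of \<open>X\<close> only.

  The past and the noise variables from time \<open>s\<close> on are mutually independent.  So if \<open>A\<close> and \<open>B\<close> are
  disjoint, the three sources are independent and the adjustment formula follows cell by cell
  (\<open>valid_adjustment_by_separate_noise\<close>).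

  That \<open>A\<close> and \<open>B\<close> are disjoint is where the graphical conditions enter.  A common member \<open>(w, s)\<close> is a
  fork with one branch to \<open>(X, s)\<close> inside time \<open>s\<close> and one branch to \<open>(Y, t)\<close>.  It makes \<open>X\<close> an
  ancestor of \<open>Y\<close>.  If \<open>\<gamma> = 0\<close>, the fork projects to an active backdoor path
  (\<open>contemporaneous_fork_backdoor_path\<close>).  If \<open>\<gamma> \<noteq> 0\<close>, the second branch may run through later
  instances of \<open>X\<close>, so the fork need not project to a path.  However, \<open>w\<close> and \<open>X\<close> lie on a common
  cycle, and as \<open>X\<close> is on no cycle of two or more vertices that avoids \<open>Y\<close>, there is a directed path
  from \<open>Y\<close> to \<open>X\<close>, which is an active backdoor path when read backwards (\<open>lagged_fork_backdoor_path\<close>).  The only case left open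
  by the conditions is \<open>\<gamma> = 1\<close> with \<open>X \<leftrightarrows> Y\<close> as the only cycle at \<open>Y\<close>; there the fork forces arcs of lag
  zero in both directions between \<open>X\<close> and \<open>Y\<close>, against the acyclicity of the full-time graph.\<close>

section \<open>Paths and cycles in digraphs\<close>

lemma rtrancl_simple_path:
  assumes "(u, v) \<in> r\<^sup>*"
  obtains p where "p \<noteq> []" "hd p = u" "last p = v" "distinct p" "successively (\<lambda>a b. (a, b) \<in> r) p"
proof -
  have "\<exists>p. p \<noteq> [] \<and> hd p = u \<and> last p = v \<and> distinct p \<and> successively (\<lambda>a b. (a, b) \<in> r) p"
    using assms
  proof (induction rule: converse_rtrancl_induct)
    case base
    then show ?case by (intro exI[of _ "[v]"]) simp
  next
    case (step u w)
    then obtain p where p: "p \<noteq> []" "hd p = w" "last p = v" "distinct p"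
      "successively (\<lambda>a b. (a, b) \<in> r) p" by blast
    show ?case
    proof (cases "u \<in> set p")
      case True
      then obtain p1 p2 where "p = p1 @ u # p2" by (auto dest: split_list)
      with p show ?thesis
        by (intro exI[of _ "u # p2"]) (auto simp: successively_append_iff)
    next
      case False
      with p step.hyps(1) show ?thesis
        by (intro exI[of _ "u # p"]) (auto simp: successively_Cons)
    qed
  qed
  with that show ?thesis by blast
qed

lemma successively_rtrancl:
  assumes "successively (\<lambda>a b. (a, b) \<in> r) p" "v \<in> set p"
  shows "(hd p, v) \<in> r\<^sup>*" "(v, last p) \<in> r\<^sup>*"
proof -
  from assms(2) obtain p1 p2 where p: "p = p1 @ v # p2" by (auto dest: split_list)
  have "(a, last q) \<in> r\<^sup>*" if "successively (\<lambda>a b. (a, b) \<in> r) q" "q \<noteq> []" "a = hd q" for q a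
    using that
    by (induction q arbitrary: a) (auto simp: successively_Cons intro: converse_rtrancl_into_rtrancl)
  from this[of "p1 @ [v]" "hd p"] this[of "v # p2" v] assms(1) show "(hd p, v) \<in> r\<^sup>*" "(v, last p) \<in> r\<^sup>*"
    unfolding p by (auto simp: successively_append_iff successively_Cons hd_append)
qed

text \<open>A trek goes up from \<open>x\<close> to the source \<open>v\<close> and then down to \<open>y\<close>.  At every inner vertex at least
  one of the two arcs of the trek leaves that vertex, so the vertex cannot be a collider, even if the
  graph contains more arcs between the same vertices.  A trek with an empty second branch is a
  directed path from \<open>y\<close> to \<open>x\<close> that is read backwards.\<close>

lemma trek_active_backdoor_path:
  assumes P: "successively (\<lambda>a b. (a, b) \<in> parcs G) (v # p)" "last (v # p) = x"
    and Q: "successively (\<lambda>a b. (a, b) \<in> parcs G) (v # q)" "last (v # q) = y"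
    and dist: "distinct (v # p @ q)" and "x \<noteq> v"
    and verts: "set (v # p @ q) \<subseteq> pverts G"
  shows "backdoor_path G x (rev (v # p) @ q) y" "sigma_active G (rev (v # p) @ q)"
proof -
  define n where "n = length (v # p)"
  define \<pi> where "\<pi> = rev (v # p) @ q"
  have pne: "p \<noteq> []" using P \<open>x \<noteq> v\<close> by auto
  \<comment> \<open>The branch towards \<open>x\<close> is traversed against its arcs.\<close>
  have backward: "(\<pi> ! Suc i, \<pi> ! i) \<in> parcs G" if "Suc i < n" for i
  proof -
    have "((v # p) ! (n - 2 - i), (v # p) ! Suc (n - 2 - i)) \<in> parcs G"
      using P(1) that unfolding successively_conv_nth n_def by auto
    moreover have "\<pi> ! i = (v # p) ! Suc (n - 2 - i)" "\<pi> ! Suc i = (v # p) ! (n - 2 - i)"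
      using that by (auto simp: \<pi>_def n_def nth_append rev_nth Suc_diff_Suc simp del: rev.simps)
    ultimately show ?thesis by simp
  qed
  have forward: "(\<pi> ! i, \<pi> ! Suc i) \<in> parcs G" if "n \<le> Suc i" "Suc i < length \<pi>" for i
  proof -
    define j where "j = Suc i - n"
    have i: "Suc i = n + j" using that by (simp add: j_def)
    have "((v # q) ! j, (v # q) ! Suc j) \<in> parcs G"
      using Q(1) that i unfolding successively_conv_nth \<pi>_def n_def by auto
    moreover have "\<pi> ! Suc i = q ! j"
      unfolding i \<pi>_def n_def nth_append by simp
    moreover have "\<pi> ! i = (v # q) ! j"
    proof (cases j)
      case 0
      then have "i = length p" using i by (simp add: n_def)
      then show ?thesis using 0 by (simp add: \<pi>_def nth_append)
    next
      case (Suc k)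
      then have "i = n + k" using i by simp
      then show ?thesis unfolding \<pi>_def n_def nth_append using Suc by simp
    qed
    ultimately show ?thesis by simp
  qed
  have "hd \<pi> = x" "last \<pi> = y"
    using P(2) Q(2) pne by (auto simp: \<pi>_def hd_append hd_rev last_append)
  moreover have "n \<ge> 2" "n \<le> length \<pi>"
    using pne by (auto simp: n_def \<pi>_def Suc_le_eq)
  ultimately show "backdoor_path G x (rev (v # p) @ q) y"
    using dist verts backward forward backward[of 0]
    unfolding backdoor_path_def path_between_def \<pi>_def[symmetric]
    by (auto simp: \<pi>_def not_less) (metis not_less)+
  show "sigma_active G (rev (v # p) @ q)"
    unfolding sigma_blocked_def only_arc_def \<pi>_def[symmetric]
    using backward forward by (metis Suc_leI le_SucI not_less)
qed

lemma (in wf_digraph) mutually_reachable_cycle: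
  assumes "v \<noteq> w" "v \<rightarrow>\<^sup>* w" "w \<rightarrow>\<^sup>* v"
  obtains C where "C \<in> directed_cycles G" "finite C" "{v, w} \<subseteq> tail G ` C"
proof -
  obtain p q where p: "apath v p w" and q: "apath w q v"
    using assms(2,3) by (auto simp: reachable_apath)
  have "v \<in> tail G ` set p"
    using p \<open>v \<noteq> w\<close> by (cases p) (auto simp: apath_def awalk_Cons_iff awalk_Nil_iff)
  moreover have "w \<in> tail G ` set q"
    using q \<open>v \<noteq> w\<close> by (cases q) (auto simp: apath_def awalk_Cons_iff awalk_Nil_iff)
  moreover have "set p \<union> set q \<in> directed_cycles G"
    unfolding directed_cycles_def using p q \<open>v \<noteq> w\<close> by blast
  ultimately show ?thesis
    by (intro that[of "set p \<union> set q"]) auto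
qed

lemma reachable_iff_rtrancl:
  assumes "pair_wf_digraph G" "u \<in> pverts G"
  shows "u \<rightarrow>\<^sup>*\<^bsub>with_proj G\<^esub> v \<longleftrightarrow> (u, v) \<in> (parcs G)\<^sup>*"
proof
  interpret pair_wf_digraph G by fact
  show "(u, v) \<in> (parcs G)\<^sup>*" if "u \<rightarrow>\<^sup>*\<^bsub>with_proj G\<^esub> v"
    using that by (induction rule: reachable_induct) auto
  show "u \<rightarrow>\<^sup>*\<^bsub>with_proj G\<^esub> v" if "(u, v) \<in> (parcs G)\<^sup>*"
    using that assms(2) by (induction rule: rtrancl_induct) (auto intro: reachable_adj_trans)
qed

text \<open>Starting from any common source \<open>w\<close>, take a simple walk from \<open>w\<close> to \<open>x\<close> and fork at its last
  vertex \<open>v\<close> that still reaches \<open>y\<close> without passing through \<open>x\<close>: no later vertex of the walk can lie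
  on the second branch, because it would be a later choice for \<open>v\<close>.\<close>

lemma exists_disjoint_trek:
  assumes wx: "(w, x) \<in> r\<^sup>*" and wy: "(w, y) \<in> {(a, b) \<in> r. a \<noteq> x}\<^sup>*"
    and "x \<noteq> y"
  obtains v p q where "(w, v) \<in> r\<^sup>*" "v \<noteq> x" "distinct (v # p @ q)"
    "successively (\<lambda>a b. (a, b) \<in> r) (v # p)" "last (v # p) = x"
    "successively (\<lambda>a b. (a, b) \<in> r) (v # q)" "last (v # q) = y"
proof -
  define R where "R = {(a, b) \<in> r. a \<noteq> x}"
  define T where "T = {u. (u, y) \<in> R\<^sup>*}"
  \<comment> \<open>Every arc of \<open>R\<close> leaves a vertex other than \<open>x\<close>, so \<open>x\<close> has no \<open>R\<close>-walk to \<open>y\<close>.\<close>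
  have "x \<notin> T"
    using \<open>x \<noteq> y\<close> by (auto simp: T_def R_def elim: converse_rtranclE)
  obtain P where P: "P \<noteq> []" "hd P = w" "last P = x" "distinct P"
      "successively (\<lambda>a b. (a, b) \<in> r) P"
    using rtrancl_simple_path[OF wx] .
  have "\<exists>u\<in>set P. u \<in> T"
    using wy P(1,2) by (auto simp: T_def R_def intro!: bexI[of _ w])
  then obtain P' v p where Pv: "P = P' @ v # p" and v: "v \<in> T" and p: "\<forall>u\<in>set p. u \<notin> T"
    by (auto dest!: split_list_last_prop)
  obtain q' where q': "q' \<noteq> []" "hd q' = v" "last q' = y" "distinct q'"
      "successively (\<lambda>a b. (a, b) \<in> R) q'"
    using rtrancl_simple_path[of v y R] v by (auto simp: T_def)
  then obtain q where q: "q' = v # q" by (cases q') auto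
  have "set q \<subseteq> T"
    using successively_rtrancl(2)[OF q'(5)] q'(3) by (auto simp: T_def q)
  then have "set p \<inter> set q = {}" "v \<noteq> x"
    using p v \<open>x \<notin> T\<close> by auto
  moreover have "successively (\<lambda>a b. (a, b) \<in> r) (v # q)"
    using q'(5) unfolding q by (rule successively_mono) (auto simp: R_def)
  moreover have "(w, v) \<in> r\<^sup>*"
    using successively_rtrancl(1)[OF P(5), of v] P(2) by (simp add: Pv)
  ultimately show ?thesis
    using that[of v p q] P q'
    by (auto simp: Pv q successively_append_iff)
qed

section \<open>Projection to the summary graph\<close>

context ftcg
begin

abbreviation summary :: "'v pair_pre_digraph" where
  "summary \<equiv> summary_of gmax G"

lemma pverts_summary [simp]: "pverts summary = V"
  by (simp add: summary_of_def verts_eq)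

lemma arc_summary:
  assumes "((x, r), (y, u)) \<in> parcs G"
  shows "(x, y) \<in> parcs summary"
proof -
  have "((x, u - int (nat (u - r))), (y, u)) \<in> parcs G"
    using assms lag_nonneg[OF assms] by simp
  then show ?thesis
    using lag_le[OF assms] by (auto simp: summary_of_def intro!: exI[of _ u] exI[of _ "nat (u - r)"])
qed

lemma summary_wf: "pair_wf_digraph summary"
  by unfold_locales (auto simp: summary_of_def verts_eq dest: in_arcsD1 in_arcsD2)

lemma walk_summary:
  assumes "(p, q) \<in> (parcs G)\<^sup>*"
  shows "(fst p, fst q) \<in> (parcs summary)\<^sup>*" "snd p \<le> snd q"
  using assms
  by (induction rule: rtrancl_induct)
    (auto dest: arc_summary lag_nonneg intro: rtrancl_into_rtrancl)

lemma Desc_summary: "x \<in> V \<Longrightarrow> z \<in> Desc x summary \<longleftrightarrow> (x, z) \<in> (parcs summary)\<^sup>*"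
  by (simp add: Desc_def reachable_iff_rtrancl[OF summary_wf])

lemma Anc_summary: "z \<in> V \<Longrightarrow> z \<in> Anc x summary \<longleftrightarrow> (z, x) \<in> (parcs summary)\<^sup>*"
  by (simp add: Anc_def reachable_iff_rtrancl[OF summary_wf])

lemma rtrancl_summary_verts:
  assumes "(x, z) \<in> (parcs summary)\<^sup>*" "x \<in> V"
  shows "z \<in> V"
  using assms by (induction rule: rtrancl_induct) (auto simp: summary_of_def verts_eq dest: in_arcsD2)

lemma lagged_parents_V:
  assumes "(z, l) \<in> lagged_parents G y"
  shows "z \<in> V" "l \<le> gmax"
  using assms in_arcsD1[of "(z, - int l)" "(y, 0)"] lag_le[of z "- int l" y 0]
  by (auto simp: lagged_parents_def verts_eq)

lemma finite_lagged_parents: "finite (lagged_parents G y)"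
  by (rule finite_subset[of _ "V \<times> {..gmax}"]) (auto simp: finite_series dest: lagged_parents_V)

lemma lagged_parents_summary: "(z, l) \<in> lagged_parents G y \<Longrightarrow> (z, y) \<in> parcs summary"
  by (auto simp: lagged_parents_def dest: arc_summary)

lemma Desc_summary_subset: "x \<in> V \<Longrightarrow> Desc x summary \<subseteq> V"
  using rtrancl_summary_verts Desc_summary by blast

lemma Desc_summary_step:
  "x \<in> V \<Longrightarrow> z \<in> Desc x summary \<Longrightarrow> (z, l) \<in> lagged_parents G y \<Longrightarrow> y \<in> Desc x summary"
  by (auto simp: Desc_summary dest: lagged_parents_summary intro: rtrancl_into_rtrancl)

end

section \<open>Forks at the time of the intervention\<close>

context ftcg
begin

text \<open>No arc goes back in time, so a walk that starts and ends at time \<open>s\<close> never leaves it.\<close>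

lemma instantaneous_walk:
  assumes "R \<subseteq> parcs G" "((w, s), (x, s)) \<in> R\<^sup>*"
  shows "(w, x) \<in> {(a, b). ((a, s), (b, s)) \<in> R}\<^sup>*"
proof -
  have "(fst p, x) \<in> {(a, b). ((a, s), (b, s)) \<in> R}\<^sup>*" if "(p, (x, s)) \<in> R\<^sup>*" "snd p = s" for p
    using that
  proof (induction rule: converse_rtrancl_induct)
    case base
    then show ?case by simp
  next
    case (step p q)
    have "(q, (x, s)) \<in> (parcs G)\<^sup>*"
      using step.hyps(2) rtrancl_mono[OF assms(1)] by blast
    then have "snd q \<le> s" using walk_summary(2) by fastforce
    moreover have "snd p \<le> snd q"
      using step.hyps(1) assms(1) walk_summary(2) by blast
    ultimately have "snd q = s" using step.prems by simp
    with step show ?case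
      by (cases p; cases q) (auto intro: converse_rtrancl_into_rtrancl)
  qed
  from this[of "(w, s)"] assms(2) show ?thesis by simp
qed

text \<open>All vertices of the fork are instances at time \<open>s\<close>, so different vertices belong to different series
  and a simple trek in the full-time graph remains simple in the summary graph.\<close>

lemma contemporaneous_fork_backdoor_path:
  assumes verts: "x \<in> V" "y \<in> V" "x \<noteq> y"
    and w: "w \<in> Desc x summary"
    and wx: "((w, s), (x, s)) \<in> (parcs G)\<^sup>*"
    and wy: "((w, s), (y, s)) \<in> {(p, q) \<in> parcs G. p \<noteq> (x, s)}\<^sup>*"
  obtains \<pi> where "backdoor_path summary x \<pi> y" "sigma_active summary \<pi>"
    "set \<pi> \<subseteq> Desc x summary" "2 \<le> length \<pi>"
proof -
  define I where "I = {(a, b). ((a, s), (b, s)) \<in> parcs G}"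
  have I: "(a, b) \<in> parcs summary" if "(a, b) \<in> I" for a b
    using that arc_summary by (auto simp: I_def)
  have 1: "(w, x) \<in> I\<^sup>*"
    using instantaneous_walk[OF _ wx] by (simp add: I_def)
  have 2: "(w, y) \<in> {(a, b) \<in> I. a \<noteq> x}\<^sup>*"
  proof -
    have "{(a, b). ((a, s), (b, s)) \<in> {(p, q) \<in> parcs G. p \<noteq> (x, s)}} = {(a, b) \<in> I. a \<noteq> x}"
      by (auto simp: I_def)
    with instantaneous_walk[OF _ wy] show ?thesis by auto
  qed
  obtain v p q where vpq: "(w, v) \<in> I\<^sup>*" "v \<noteq> x" "distinct (v # p @ q)"
    "successively (\<lambda>a b. (a, b) \<in> I) (v # p)" "last (v # p) = x"
    "successively (\<lambda>a b. (a, b) \<in> I) (v # q)" "last (v # q) = y"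
    using exists_disjoint_trek[OF 1 2 verts(3)] .
  have succ: "successively (\<lambda>a b. (a, b) \<in> parcs summary) (v # p)"
    "successively (\<lambda>a b. (a, b) \<in> parcs summary) (v # q)"
    using vpq(4,6) I by (auto elim!: successively_mono)
  have "I \<subseteq> parcs summary" using I by auto
  then have "(w, v) \<in> (parcs summary)\<^sup>*"
    using vpq(1) rtrancl_mono by blast
  then have xv: "(x, v) \<in> (parcs summary)\<^sup>*"
    using w verts(1) by (auto simp: Desc_summary)
  have desc: "(x, u) \<in> (parcs summary)\<^sup>*" if "u \<in> set (v # p @ q)" for u
    using that rtrancl_trans[OF xv] successively_rtrancl(1)[OF succ(1), of u]
      successively_rtrancl(1)[OF succ(2), of u] by auto
  have "set (v # p @ q) \<subseteq> pverts summary"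
    using desc rtrancl_summary_verts[OF _ verts(1)] by auto
  note path = trek_active_backdoor_path[OF succ(1) vpq(5) succ(2) vpq(7,3) vpq(2)[symmetric] this]
  show ?thesis
  proof (rule that[OF path])
    show "set (rev (v # p) @ q) \<subseteq> Desc x summary"
      using desc verts(1) by (auto simp: Desc_summary)
    show "2 \<le> length (rev (v # p) @ q)"
      using path(1) by (simp add: backdoor_path_def)
  qed
qed

text \<open>A walk to \<open>v\<close> can meet \<open>y\<close> only if \<open>y\<close> reaches \<open>v\<close>.\<close>

lemma reachable_del_vert_summary:
  assumes "(u, v) \<in> (parcs summary)\<^sup>*" "(y, v) \<notin> (parcs summary)\<^sup>*" "u \<in> V"
  shows "u \<rightarrow>\<^sup>*\<^bsub>pre_digraph.del_vert (with_proj summary) y\<^esub> v"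
proof -
  interpret S: pair_wf_digraph summary by (rule summary_wf)
  interpret H: wf_digraph "pre_digraph.del_vert (with_proj summary) y"
    by (rule S.wf_digraph_del_vert)
  show ?thesis
    using assms(1,3)
  proof (induction rule: converse_rtrancl_induct)
    case base
    then show ?case using assms(2) by (auto simp: S.del_vert_simps)
  next
    case (step u u')
    have "u \<noteq> y" "u' \<noteq> y"
      using step.hyps assms(2) by (auto intro: converse_rtrancl_into_rtrancl)
    then have "(u, u') \<in> arcs_ends (pre_digraph.del_vert (with_proj summary) y)"
      using step.hyps(1) by (force simp: S.del_vert_simps arcs_ends_conv)
    moreover have "u' \<in> V"
      using rtrancl_summary_verts[OF r_into_rtrancl, OF step.hyps(1) step.prems] .
    ultimately show ?case
      using step.IH H.adj_reachable_trans by blast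
  qed
qed

text \<open>The fork itself cannot be used, as its branch to \<open>y\<close> may visit later instances of \<open>x\<close> and so repeat
  \<open>x\<close> in the summary graph.  The backdoor path found here is instead a directed path from \<open>y\<close> to \<open>x\<close>,
  which exists because \<open>w\<close> and \<open>x\<close> are mutually reachable although \<open>x\<close> is on no cycle of two or more
  vertices that avoids \<open>y\<close>.\<close>

lemma lagged_fork_backdoor_path:
  assumes verts: "x \<in> V" "y \<in> V" "x \<noteq> y" and "\<gamma> \<noteq> 0"
    and cycles: "Cycles_gt x (pre_digraph.del_vert (with_proj summary) y) = {}"
    and w: "w \<in> Desc x summary" "w \<noteq> x"
    and wx: "((w, s), (x, s)) \<in> (parcs G)\<^sup>*"
    and wy: "((w, s), (y, s + int \<gamma>)) \<in> {(p, q) \<in> parcs G. p \<noteq> (x, s)}\<^sup>*"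
  shows "\<exists>\<pi>. backdoor_path summary x \<pi> y \<and> sigma_active summary \<pi> \<and>
    set \<pi> \<subseteq> Desc x summary \<and>
    (length \<pi> > 2 \<or> length \<pi> = 2 \<and> \<gamma> \<noteq> 1 \<or>
     length \<pi> = 2 \<and> \<gamma> = 1 \<and> Cycles y summary - {{(x, y), (y, x)}} \<noteq> {})"
proof -
  interpret S: pair_wf_digraph summary by (rule summary_wf)
  interpret H: wf_digraph "pre_digraph.del_vert (with_proj summary) y"
    by (rule S.wf_digraph_del_vert)
  let ?R = "{(p, q) \<in> parcs G. p \<noteq> (x, s)}"
  have R: "?R\<^sup>* \<subseteq> (parcs G)\<^sup>*" by (rule rtrancl_mono) auto
  have xw_S: "(x, w) \<in> (parcs summary)\<^sup>*" using w(1) verts(1) by (simp add: Desc_summary)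
  have wx_S: "(w, x) \<in> (parcs summary)\<^sup>*" using walk_summary(1)[OF wx] by simp
  have wy_S: "(w, y) \<in> (parcs summary)\<^sup>*" using walk_summary(1)[OF subsetD[OF R wy]] by simp
  have "w \<in> V" by (rule rtrancl_summary_verts[OF xw_S verts(1)])
  \<comment> \<open>Otherwise the walks between \<open>x\<close> and \<open>w\<close> avoid \<open>y\<close> and form a cycle in the graph without \<open>y\<close>.\<close>
  have yx_S: "(y, x) \<in> (parcs summary)\<^sup>*"
  proof (rule ccontr)
    assume yx: "(y, x) \<notin> (parcs summary)\<^sup>*"
    have "x \<rightarrow>\<^sup>*\<^bsub>pre_digraph.del_vert (with_proj summary) y\<^esub> w"
      using yx wx_S by (intro reachable_del_vert_summary xw_S verts(1)) (auto dest: rtrancl_trans)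
    moreover have "w \<rightarrow>\<^sup>*\<^bsub>pre_digraph.del_vert (with_proj summary) y\<^esub> x"
      by (intro reachable_del_vert_summary wx_S yx \<open>w \<in> V\<close>)
    ultimately obtain C where C: "C \<in> directed_cycles (pre_digraph.del_vert (with_proj summary) y)"
        "finite C" "{x, w} \<subseteq> tail (pre_digraph.del_vert (with_proj summary) y) ` C"
      using H.mutually_reachable_cycle[of x w] w(2) by metis
    have "card {x, w} \<le> card (tail (pre_digraph.del_vert (with_proj summary) y) ` C)"
      using C by (intro card_mono) auto
    with C w(2) have "C \<in> Cycles_gt x (pre_digraph.del_vert (with_proj summary) y)"
      by (auto simp: Cycles_gt_def Cycles_def)
    with cycles show False by simp
  qed
  obtain p' where p': "p' \<noteq> []" "hd p' = y" "last p' = x" "distinct p'"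
      "successively (\<lambda>a b. (a, b) \<in> parcs summary) p'"
    using rtrancl_simple_path[OF yx_S] .
  then obtain p where p: "p' = y # p" by (cases p') auto
  define \<pi> where "\<pi> = rev p @ [y]"
  have desc: "(x, u) \<in> (parcs summary)\<^sup>*" if "u \<in> set p'" for u
    using rtrancl_trans[OF rtrancl_trans[OF xw_S wy_S]] successively_rtrancl(1)[OF p'(5) that] p'(2)
    by simp
  have "distinct (y # p @ [])" "set (y # p @ []) \<subseteq> pverts summary"
    using p'(4) desc rtrancl_summary_verts[OF _ verts(1)] by (auto simp: p)
  note path = trek_active_backdoor_path[of summary y p x "[]" y,
      OF p'(5)[unfolded p] p'(3)[unfolded p] _ _ this(1) verts(3) this(2), simplified, folded \<pi>_def]
  have set_\<pi>: "set \<pi> \<subseteq> Desc x summary"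
    using desc verts(1) by (auto simp: Desc_summary \<pi>_def p)
  show ?thesis
  proof (rule ccontr)
    assume "\<not> ?thesis"
    with path set_\<pi> have \<pi>: "length \<pi> = 2" "\<gamma> = 1" and cyc: "Cycles y summary \<subseteq> {{(x, y), (y, x)}}"
      unfolding backdoor_path_def by (metis Diff_eq_empty_iff le_neq_implies_less)+
    \<comment> \<open>What remains is \<open>\<gamma> = 1\<close>, where \<open>y\<close> is on no cycle except \<open>x \<leftrightarrows> y\<close>: its component is \<open>{x, y}\<close>.\<close>
    have scc: "v \<in> {x, y}" if "(y, v) \<in> (parcs summary)\<^sup>*" "(v, y) \<in> (parcs summary)\<^sup>*" for v
    proof (rule ccontr)
      assume "v \<notin> {x, y}"
      have "v \<in> V" by (rule rtrancl_summary_verts[OF that(1) verts(2)])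
      then have "y \<rightarrow>\<^sup>*\<^bsub>with_proj summary\<^esub> v" "v \<rightarrow>\<^sup>*\<^bsub>with_proj summary\<^esub> y"
        using that verts(2) by (simp_all add: reachable_iff_rtrancl[OF summary_wf])
      then obtain C where "C \<in> directed_cycles (with_proj summary)" "finite C" "{y, v} \<subseteq> fst ` C"
        using S.mutually_reachable_cycle[of y v] \<open>v \<notin> {x, y}\<close> by (metis insertI1 insert_commute with_proj_simps(3))
      with cyc have "{y, v} \<subseteq> fst ` {(x, y), (y, x)}"
        by (fastforce simp: Cycles_def)
      with \<open>v \<notin> {x, y}\<close> show False by auto
    qed
    have no_loop: "(y, y) \<notin> parcs summary"
    proof
      assume "(y, y) \<in> parcs summary"
      then have "{(y, y)} \<in> Cycles y summary" by (force simp: Cycles_def directed_cycles_def)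
      with cyc verts(3) show False by auto
    qed
    have "w = y"
      using scc[of w] rtrancl_trans[OF yx_S xw_S] wy_S w(2) by auto
    have from_y: "v = x" if "((y, s), (v, r)) \<in> parcs G" "(v, y) \<in> (parcs summary)\<^sup>*" for v r
      using scc[of v] arc_summary[OF that(1)] that(2) no_loop by auto
    have xy_S: "(x, y) \<in> (parcs summary)\<^sup>*" using rtrancl_trans[OF xw_S wy_S] .
    have yx_s: "((y, s), (x, s)) \<in> parcs G"
    proof -
      obtain v r where v: "((y, s), (v, r)) \<in> parcs G" "((v, r), (x, s)) \<in> (parcs G)\<^sup>*"
        using wx unfolding \<open>w = y\<close>
        by (cases rule: converse_rtranclE) (use verts(3) in auto)
      have "v = x"
        by (rule from_y[OF v(1) rtrancl_trans[OF walk_summary(1)[OF v(2), simplified] xy_S]])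
      moreover have "r = s"
        using walk_summary(2)[OF v(2)] lag_nonneg[OF v(1)] by simp
      ultimately show ?thesis using v(1) by simp
    qed
    \<comment> \<open>The other branch has to start with the arc from \<open>(y, s)\<close> to \<open>(x, s + 1)\<close> and stays in time \<open>s + 1\<close>.\<close>
    have xy_s: "((x, s + 1), (y, s + 1)) \<in> (parcs G)\<^sup>*"
    proof -
      obtain v r where v: "((y, s), (v, r)) \<in> ?R" "((v, r), (y, s + 1)) \<in> ?R\<^sup>*"
        using wy unfolding \<open>w = y\<close> \<open>\<gamma> = 1\<close>
        by (cases rule: converse_rtranclE) auto
      then have v': "((v, r), (y, s + 1)) \<in> (parcs G)\<^sup>*" using R by blast
      have v'': "((y, s), (v, r)) \<in> parcs G" using v(1) by auto
      have "v = x"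
        by (rule from_y[OF v'' walk_summary(1)[OF v', simplified]])
      moreover have "(v, r) \<noteq> (x, s)"
        using v(2) by (cases rule: converse_rtranclE) (use verts(3) in auto)
      moreover have "s \<le> r" "r \<le> s + 1"
        using walk_summary(2)[OF v'] lag_nonneg[OF v''] by auto
      ultimately have "v = x" "r = s + 1" by auto
      with v' show ?thesis by simp
    qed
    \<comment> \<open>The arc at time \<open>s\<close>, shifted by one, closes a cycle at time \<open>s + 1\<close>.\<close>
    have "((y, s + 1), (x, s + 1)) \<in> parcs G"
      using yx_s consistency by blast
    with xy_s acyclic_arcs show False
      by (auto simp: acyclic_def dest: rtrancl_into_trancl2)
  qed
qed

end

section \<open>Independent sources of randomness\<close>

text \<open>Countable additivity for families whose index set is countable but not enumerated, in the form of
  an unordered sum.\<close>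

lemma (in finite_measure) measure_UN_has_sum:
  assumes I: "countable I" and X: "\<And>i. i \<in> I \<Longrightarrow> X i \<in> sets M" and disj: "disjoint_family_on X I"
  shows "((\<lambda>i. measure M (X i)) has_sum measure M (\<Union>i\<in>I. X i)) I"
proof -
  have "(\<integral>\<^sup>+i. ennreal (measure M (X i)) \<partial>count_space I) = ennreal (measure M (\<Union>i\<in>I. X i))"
    using emeasure_UN_countable[OF X I disj] by (simp add: emeasure_eq_measure)
  then have "has_bochner_integral (count_space I) (\<lambda>i. measure M (X i)) (measure M (\<Union>i\<in>I. X i))"
    by (intro has_bochner_integral_nn_integral) auto
  then have "Infinite_Set_Sum.abs_summable_on (\<lambda>i. measure M (X i)) I"
    "infsetsum (\<lambda>i. measure M (X i)) I = measure M (\<Union>i\<in>I. X i)"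
    by (auto simp: abs_summable_on_def infsetsum_def has_bochner_integral_iff)
  then show ?thesis
    by (metis abs_summable_equivalent abs_summable_summable has_sum_infsum infsetsum_infsum)
qed

context dscm
begin

definition past :: "int \<Rightarrow> 'w measure" where
  "past s = vimage_algebra (space M) (\<lambda>\<omega>. \<lambda>p\<in>V \<times> {..<s}. obs p \<omega>)
     (\<Pi>\<^sub>M (y, r)\<in>V \<times> {..<s}. count_space (D y))"

text \<open>The randomness of the model from time \<open>s\<close> on comes from one source for the whole past before \<open>s\<close>,
  with index \<open>None\<close>, and one source for the noise of each later variable \<open>p\<close>, with index \<open>Some p\<close>.\<close>

definition source_events :: "int \<Rightarrow> ('v \<times> int) option \<Rightarrow> 'w set set" where
  "source_events s i = (case i of None \<Rightarrow> sets (past s)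
     | Some p \<Rightarrow> {noise p -` A \<inter> space M | A. A \<in> sets (N (fst p))})"

definition sources :: "int \<Rightarrow> ('v \<times> int) option set" where
  "sources s = insert None (Some ` (V \<times> {s..}))"

text \<open>A measure type carries the \<open>\<sigma>\<close>-algebra, so that measurability with respect to it can be stated as
  usual; the (zero) measure that comes with it has no meaning.\<close>

definition info :: "int \<Rightarrow> ('v \<times> int) option set \<Rightarrow> 'w measure" where
  "info s K = sigma (space M) (\<Union>i\<in>K. source_events s i)"

lemma space_past [simp]: "space (past s) = space M"
  by (simp add: past_def)

lemma source_events_subset: "source_events s i \<subseteq> Pow (space M)"
  using sets.sets_into_space[of _ "past s"] by (auto simp: source_events_def split: option.splits)

lemma space_info [simp]: "space (info s K) = space M"
  by (simp add: info_def space_measure_of_conv)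

lemma sets_info: "sets (info s K) = sigma_sets (space M) (\<Union>i\<in>K. source_events s i)"
  unfolding info_def using source_events_subset by (intro sets_measure_of) blast

lemma noise_measurable: "p \<in> V \<times> UNIV \<Longrightarrow> noise p \<in> M \<rightarrow>\<^sub>M N (fst p)"
  using noise_indep by (auto simp: indep_vars_def2 split: prod.splits)

lemma noise_measurable_info:
  assumes "Some p \<in> K" "p \<in> V \<times> UNIV"
  shows "noise p \<in> info s K \<rightarrow>\<^sub>M N (fst p)"
proof (rule measurableI)
  show "noise p \<omega> \<in> space (N (fst p))" if "\<omega> \<in> space (info s K)" for \<omega>
    using measurable_space[OF noise_measurable[OF assms(2)]] that by simp
  show "noise p -` A \<inter> space (info s K) \<in> sets (info s K)" if "A \<in> sets (N (fst p))" for A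
    unfolding sets_info space_info using assms(1) that
    by (intro sigma_sets.Basic UN_I[of "Some p"]) (auto simp: source_events_def)
qed

lemma past_measurable_info:
  assumes "None \<in> K" "p \<in> V \<times> {..<s}"
  shows "obs p \<in> info s K \<rightarrow>\<^sub>M count_space (D (fst p))"
proof -
  let ?past = "\<lambda>\<omega>. \<lambda>p\<in>V \<times> {..<s}. obs p \<omega>" and ?D = "\<lambda>(y, r). count_space (D y)"
  have "?past \<in> space M \<rightarrow> space (\<Pi>\<^sub>M p\<in>V \<times> {..<s}. ?D p)"
    using measurable_space[OF obs_measurable] by (fastforce simp: space_PiM)
  then have "?past \<in> past s \<rightarrow>\<^sub>M (\<Pi>\<^sub>M p\<in>V \<times> {..<s}. ?D p)"
    unfolding past_def by (rule measurable_vimage_algebra1)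
  from measurable_compose[OF this measurable_component_singleton[OF assms(2)]]
  have "(\<lambda>\<omega>. ?past \<omega> p) \<in> past s \<rightarrow>\<^sub>M ?D p" .
  then have *: "obs p \<in> past s \<rightarrow>\<^sub>M count_space (D (fst p))"
    using assms(2) by (simp add: restrict_def split_beta)
  moreover have "sets (past s) \<subseteq> sets (info s K)"
    unfolding sets_info using assms(1)
    by (auto simp: source_events_def intro!: sigma_sets.Basic bexI[of _ None])
  ultimately show ?thesis
    by (auto simp: measurable_def)
qed

text \<open>The noise variables are independent of each other, and all noise from time \<open>s\<close> on is independent of
  the past as a whole by nonanticipation; together this is mutual independence of the sources.\<close>

lemma indep_sources: "indep_sets (source_events s) (sources s)"
proof -
  let ?noise = "\<lambda>\<omega>. \<lambda>p\<in>V \<times> {s..}. noise p \<omega>" and ?N = "\<lambda>(y, r). N y"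
  define future where "future = vimage_algebra (space M) ?noise (\<Pi>\<^sub>M p\<in>V \<times> {s..}. ?N p)"
  have indep: "indep_set (sets (past s)) (sets future)"
    using nonanticipating[of s] by (simp add: past_def future_def)
  have indep_noise: "indep_sets (\<lambda>p. source_events s (Some p)) (V \<times> UNIV)"
    using noise_indep by (simp add: indep_vars_def2 source_events_def split_beta)
  have in_future: "source_events s (Some p) \<subseteq> sets future" if p: "p \<in> V \<times> {s..}" for p
  proof -
    have "?noise \<in> space M \<rightarrow> space (\<Pi>\<^sub>M p\<in>V \<times> {s..}. ?N p)"
      using measurable_space[OF noise_measurable] by (fastforce simp: space_PiM)
    then have "?noise \<in> future \<rightarrow>\<^sub>M (\<Pi>\<^sub>M p\<in>V \<times> {s..}. ?N p)"
      unfolding future_def by (rule measurable_vimage_algebra1)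
    from measurable_compose[OF this measurable_component_singleton[OF p]]
    have "noise p \<in> future \<rightarrow>\<^sub>M N (fst p)"
      using p by (simp add: split_beta)
    from measurable_sets[OF this] show ?thesis
      by (auto simp: source_events_def future_def)
  qed
  have noise_prod: "prob (\<Inter>p\<in>K. A (Some p)) = (\<Prod>p\<in>K. prob (A (Some p)))"
    if "finite K" "K \<noteq> {}" "K \<subseteq> V \<times> {s..}" "\<And>p. p \<in> K \<Longrightarrow> A (Some p) \<in> source_events s (Some p)"
    for K A
    using indep_setsD[OF indep_noise, of K "\<lambda>p. A (Some p)"] that by auto
  show ?thesis
  proof (rule indep_setsI)
    fix i assume "i \<in> sources s"
    then show "source_events s i \<subseteq> events"
      using indep_setD_ev1[OF indep] indep_noise
      by (auto simp: sources_def indep_sets_def source_events_def[of s None])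
  next
    fix A J assume J: "J \<noteq> {}" "J \<subseteq> sources s" "finite J" "\<forall>j\<in>J. A j \<in> source_events s j"
    define K where "K = {p. Some p \<in> J}"
    have K: "finite K" "K \<subseteq> V \<times> {s..}" "\<And>p. p \<in> K \<Longrightarrow> A (Some p) \<in> source_events s (Some p)"
      using J finite_imageD[of Some K] finite_subset[of "Some ` K" J]
      by (auto simp: K_def sources_def)
    show "prob (\<Inter>j\<in>J. A j) = (\<Prod>j\<in>J. prob (A j))"
    proof (cases "None \<in> J")
      case False
      have "J = Some ` K"
      proof -
        have "j \<in> Some ` K" if "j \<in> J" for j
          using that False by (cases j) (auto simp: K_def)
        then show ?thesis by (auto simp: K_def)
      qed
      then show ?thesis
        using noise_prod[OF K(1) _ K(2,3)] J(1) by (simp add: prod.reindex)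
    next
      case True
      have JK: "J = insert None (Some ` K)"
      proof -
        have "j \<in> insert None (Some ` K)" if "j \<in> J" for j
          using that by (cases j) (auto simp: K_def)
        then show ?thesis using True by (auto simp: K_def)
      qed
      show ?thesis
      proof (cases "K = {}")
        case True
        then show ?thesis by (simp add: JK)
      next
        case False
        have "prob (A None \<inter> (\<Inter>p\<in>K. A (Some p))) = prob (A None) * prob (\<Inter>p\<in>K. A (Some p))"
        proof (rule indep_setD[OF indep])
          show "A None \<in> sets (past s)"
            using J(4) \<open>None \<in> J\<close> by (auto simp: source_events_def)
          show "(\<Inter>p\<in>K. A (Some p)) \<in> sets future"
            using K in_future False by (intro sets.finite_INT) blast+
        qed
        then show ?thesis
          using noise_prod[OF K(1) False K(2,3)] K(1) by (simp add: JK prod.reindex)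
      qed
    qed
  qed
qed

lemma indep_info:
  assumes "disjoint_family_on K J" "\<And>j. j \<in> J \<Longrightarrow> K j \<subseteq> sources s"
  shows "indep_sets (\<lambda>j. sets (info s (K j))) J"
  unfolding sets_info
proof (rule indep_sets_collect_sigma)
  show "indep_sets (source_events s) (\<Union>j\<in>J. K j)"
    by (rule indep_sets_mono_index[OF _ indep_sources]) (use assms(2) in blast)
  show "Int_stable (source_events s i)" for i
  proof (rule Int_stableI)
    fix a b assume "a \<in> source_events s i" "b \<in> source_events s i"
    then show "a \<inter> b \<in> source_events s i"
    proof (cases i)
      case None
      with \<open>a \<in> _\<close> \<open>b \<in> _\<close> show ?thesis by (auto simp: source_events_def)
    next
      case (Some p)
      with \<open>a \<in> _\<close> \<open>b \<in> _\<close> obtain A B where "A \<in> sets (N (fst p))" "B \<in> sets (N (fst p))"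
        "a = noise p -` A \<inter> space M" "b = noise p -` B \<inter> space M"
        by (auto simp: source_events_def)
      then show ?thesis
        by (auto simp: Some source_events_def intro!: exI[of _ "A \<inter> B"])
    qed
  qed
qed (fact assms(1))

lemma prob_Int_info:
  assumes disj: "K\<^sub>1 \<inter> K\<^sub>2 = {}" "K\<^sub>1 \<inter> K\<^sub>3 = {}" "K\<^sub>2 \<inter> K\<^sub>3 = {}"
    and sub: "K\<^sub>1 \<subseteq> sources s" "K\<^sub>2 \<subseteq> sources s" "K\<^sub>3 \<subseteq> sources s"
    and ev: "P \<in> sets (info s K\<^sub>1)" "Q \<in> sets (info s K\<^sub>2)" "R \<in> sets (info s K\<^sub>3)"
  shows "prob (P \<inter> Q \<inter> R) = prob P * prob Q * prob R"
proof -
  define K where "K j = (if j = 0 then K\<^sub>1 else if j = 1 then K\<^sub>2 else K\<^sub>3)" for j :: nat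
  define E where "E j = (if j = 0 then P else if j = 1 then Q else R)" for j :: nat
  have "indep_sets (\<lambda>j. sets (info s (K j))) {0, 1, 2}"
    using disj sub by (intro indep_info) (auto simp: disjoint_family_on_def K_def)
  from indep_setsD[OF this, of "{0, 1, 2}" E] show ?thesis
    using ev by (simp add: E_def K_def Int_ac mult_ac)
qed

lemma sets_info_subset: "K \<subseteq> sources s \<Longrightarrow> sets (info s K) \<subseteq> events"
  unfolding sets_info using indep_sources
  by (intro sets.sigma_sets_subset) (auto simp: indep_sets_def)

text \<open>Backward solution of the structural equations.  The set \<open>S\<close> contains variables that are already
  known to be determined by the sources in \<open>K\<close> on the event \<open>E\<close> and variables that are computed from
  parents in \<open>S\<close> and noise in \<open>K\<close>; induction along the arcs shows that then all of \<open>S\<close> is determined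
  by \<open>K\<close>.  The assignment \<open>val\<close> is the observed solution in some applications and the solution after
  an intervention in others, and conditioning on \<open>Z\<close> amounts to an event \<open>E\<close> on which \<open>Z\<close> is constant.\<close>

lemma solution_measurable:
  assumes K: "K \<subseteq> sources s" and S: "S \<subseteq> V \<times> UNIV" and E: "E \<subseteq> space M"
    and step: "\<And>p. p \<in> S \<Longrightarrow>
      (\<exists>h\<in>info s K \<rightarrow>\<^sub>M count_space (D (fst p)). \<forall>\<omega>\<in>E. val \<omega> p = h \<omega>) \<or>
      (s \<le> snd p \<and> Some p \<in> K \<and> (\<forall>(z, l)\<in>lagged_parents G (fst p). (z, snd p - int l) \<in> S) \<and>
       (\<forall>\<omega>\<in>E. val \<omega> p =
          f (fst p) (\<lambda>(z, l)\<in>lagged_parents G (fst p). val \<omega> (z, snd p - int l)) (noise p \<omega>)))"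
    and "p \<in> S"
  shows "\<exists>h\<in>info s K \<rightarrow>\<^sub>M count_space (D (fst p)). \<forall>\<omega>\<in>E. val \<omega> p = h \<omega>"
  using wf_arcs_from[of s] \<open>p \<in> S\<close>
proof (induction p rule: wf_induct_rule)
  case (less p)
  from step[OF less.prems] show ?case
  proof (elim disjE conjE)
    let ?L = "lagged_parents G (fst p)" and ?q = "\<lambda>(z, l). (z, snd p - int l)"
    assume p: "s \<le> snd p" "Some p \<in> K" and par: "\<forall>(z, l)\<in>?L. (z, snd p - int l) \<in> S"
      and eq: "\<forall>\<omega>\<in>E. val \<omega> p =
          f (fst p) (\<lambda>(z, l)\<in>?L. val \<omega> (z, snd p - int l)) (noise p \<omega>)"
    have "\<exists>h\<in>info s K \<rightarrow>\<^sub>M count_space (D (fst (?q i))). \<forall>\<omega>\<in>E. val \<omega> (?q i) = h \<omega>"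
      if "i \<in> ?L" for i
      using that par p(1) lagged_parents_arc[of "fst i" "snd i" "fst p" "snd p"]
      by (intro less.IH) (auto simp: split_beta)
    then have "\<forall>i\<in>?L. \<exists>h. h \<in> info s K \<rightarrow>\<^sub>M count_space (D (fst i)) \<and> (\<forall>\<omega>\<in>E. val \<omega> (?q i) = h \<omega>)"
      by (fastforce simp: split_beta)
    from bchoice[OF this] obtain h where h: "\<And>i. i \<in> ?L \<Longrightarrow> h i \<in> info s K \<rightarrow>\<^sub>M count_space (D (fst i))"
      "\<And>i \<omega>. i \<in> ?L \<Longrightarrow> \<omega> \<in> E \<Longrightarrow> val \<omega> (?q i) = h i \<omega>" by blast
    define pa where "pa \<omega> = (\<lambda>i\<in>?L. h i \<omega>)" for \<omega>
    have "fst p \<in> V" using S less.prems by auto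
    note fin = finite_lagged_parents[of "fst p"]
    have LV: "fst i \<in> V" if "i \<in> ?L" for i
      using that lagged_parents_V by (cases i) auto
    let ?PA = "\<Pi>\<^sub>E (z, l)\<in>?L. D z"
    have cPA: "countable ?PA"
      using LV by (intro countable_PiE fin) (auto intro!: countable_domain)
    have pa: "pa \<in> info s K \<rightarrow>\<^sub>M count_space ?PA"
    proof -
      have "pa \<in> info s K \<rightarrow>\<^sub>M (\<Pi>\<^sub>M i\<in>?L. count_space (D (fst i)))"
        unfolding pa_def using h(1) by (rule measurable_restrict)
      \<comment> \<open>The domains of series outside \<open>V\<close> may be uncountable, hence the empty default value off \<open>?L\<close>.\<close>
      also have "(\<Pi>\<^sub>M i\<in>?L. count_space (D (fst i))) =
          (\<Pi>\<^sub>M i\<in>?L. count_space (if i \<in> ?L then D (fst i) else {}))"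
        by (intro PiM_cong) auto
      also have "\<dots> = count_space (\<Pi>\<^sub>E i\<in>?L. if i \<in> ?L then D (fst i) else {})"
        using LV countable_domain by (intro count_space_PiM_finite fin) auto
      also have "(\<Pi>\<^sub>E i\<in>?L. if i \<in> ?L then D (fst i) else {}) = (\<Pi>\<^sub>E i\<in>?L. D (fst i))"
        by (intro PiE_cong) auto
      finally show ?thesis by (simp add: case_prod_beta')
    qed
    have "(\<lambda>\<omega>. f (fst p) (pa \<omega>) (noise p \<omega>)) \<in> info s K \<rightarrow>\<^sub>M count_space (D (fst p))"
    proof (rule measurable_compose_countable'[OF _ pa cPA])
      fix a assume "a \<in> ?PA"
      then show "(\<lambda>\<omega>. f (fst p) a (noise p \<omega>)) \<in> info s K \<rightarrow>\<^sub>M count_space (D (fst p))"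
        using p less.prems S \<open>fst p \<in> V\<close>
        by (intro measurable_compose[OF noise_measurable_info mechanism_measurable]) auto
    qed
    moreover have "val \<omega> p = f (fst p) (pa \<omega>) (noise p \<omega>)" if "\<omega> \<in> E" for \<omega>
    proof -
      have "(\<lambda>(z, l)\<in>?L. val \<omega> (z, snd p - int l)) = pa \<omega>"
        using h(2) that by (auto simp: pa_def split_beta restrict_def)
      with eq that show ?thesis by simp
    qed
    ultimately show ?thesis
      by (intro bexI[of _ "\<lambda>\<omega>. f (fst p) (pa \<omega>) (noise p \<omega>)"] ballI)
  qed
qed

text \<open>Outside a null set the observed values solve all structural equations at once, because there are
  only countably many.  On this event the arguments below are pointwise.\<close>

definition solved :: "'w set" where
  "solved = {\<omega> \<in> space M. \<forall>(y, t)\<in>V \<times> UNIV. obs (y, t) \<omega> =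
     f y (\<lambda>(z, l)\<in>lagged_parents G y. obs (z, t - int l) \<omega>) (noise (y, t) \<omega>)}"

lemma AE_solved: "AE \<omega> in M. \<omega> \<in> solved"
proof -
  have "countable (V \<times> (UNIV :: int set))"
    using finite_series by (auto intro: countable_finite)
  then have "AE \<omega> in M. \<forall>(y, t)\<in>V \<times> UNIV. obs (y, t) \<omega> =
     f y (\<lambda>(z, l)\<in>lagged_parents G y. obs (z, t - int l) \<omega>) (noise (y, t) \<omega>)"
    unfolding split_beta by (subst AE_ball_countable) (auto intro!: structural[unfolded split_beta])
  then show ?thesis by (auto simp: solved_def)
qed

lemma obs_structural:
  assumes "\<omega> \<in> solved" "fst p \<in> V"
  shows "obs p \<omega> = f (fst p)
    (\<lambda>(z, l)\<in>lagged_parents G (fst p). obs (z, snd p - int l) \<omega>) (noise p \<omega>)"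
  using assms by (cases p) (auto simp: solved_def)

declare do_obs.simps [simp del]

lemma do_obs_past: "snd p < s \<Longrightarrow> do_obs x s a \<omega> p = obs p \<omega>"
  by (cases p) (simp add: do_obs.simps)

lemma do_obs_intervened: "do_obs x s a \<omega> (x, s) = a"
  by (simp add: do_obs.simps)

lemma do_obs_structural:
  assumes "s \<le> snd p" "p \<noteq> (x, s)"
  shows "do_obs x s a \<omega> p = f (fst p)
    (\<lambda>(z, l)\<in>lagged_parents G (fst p). do_obs x s a \<omega> (z, snd p - int l)) (noise p \<omega>)"
proof -
  obtain y r where p: "p = (y, r)" by fastforce
  show ?thesis
    using assms by (auto simp: p do_obs.simps[of x s a \<omega> y r])
qed

text \<open>Two facts with the same inductive proof: an intervention that imposes the observed value changes
  nothing, and an intervention on \<open>x\<close> never changes a nondescendant of \<open>x\<close>.\<close>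

lemma do_obs_eq_obs:
  assumes \<omega>: "\<omega> \<in> solved" and "x \<in> V" and "fst p \<in> V"
    and "obs (x, s) \<omega> = a \<or> fst p \<notin> Desc x summary"
  shows "do_obs x s a \<omega> p = obs p \<omega>"
  using wf_arcs_from[of s] assms(3,4)
proof (induction p rule: wf_induct_rule)
  case (less p)
  consider "snd p < s" | "p = (x, s)" | "s \<le> snd p" "p \<noteq> (x, s)" by fastforce
  then show ?case
  proof cases
    case 1
    then show ?thesis by (rule do_obs_past)
  next
    case 2
    then show ?thesis
      using less.prems(2) \<open>x \<in> V\<close> by (auto simp: do_obs_intervened Desc_summary)
  next
    case 3
    let ?L = "lagged_parents G (fst p)"
    have "do_obs x s a \<omega> (z, snd p - int l) = obs (z, snd p - int l) \<omega>" if zl: "(z, l) \<in> ?L" for z l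
    proof (rule less.IH)
      show "((z, snd p - int l), p) \<in> {(p, q). (p, q) \<in> parcs G \<and> s \<le> snd q}"
        using lagged_parents_arc[OF zl, of "snd p"] 3 by simp
      show "fst (z, snd p - int l) \<in> V" using lagged_parents_V[OF zl] by simp
      show "obs (x, s) \<omega> = a \<or> fst (z, snd p - int l) \<notin> Desc x summary"
        using less.prems(2) Desc_summary_step[OF \<open>x \<in> V\<close> _ zl] by auto
    qed
    then have "(\<lambda>(z, l)\<in>?L. do_obs x s a \<omega> (z, snd p - int l)) =
        (\<lambda>(z, l)\<in>?L. obs (z, snd p - int l) \<omega>)"
      by (intro restrict_ext) auto
    then show ?thesis
      using do_obs_structural[OF 3] obs_structural[OF \<omega> less.prems(1)] by simp
  qed
qed

text \<open>The values after an intervention solve their equations on all of \<open>space M\<close>, so with all sources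
  available the backward solution yields measurability without an exceptional null set.\<close>

lemma do_obs_measurable:
  assumes "x \<in> V" "a \<in> D x" "p \<in> V \<times> UNIV"
  shows "(\<lambda>\<omega>. do_obs x s a \<omega> p) \<in> M \<rightarrow>\<^sub>M count_space (D (fst p))"
proof -
  have "\<exists>h\<in>info s (sources s) \<rightarrow>\<^sub>M count_space (D (fst p)). \<forall>\<omega>\<in>space M. do_obs x s a \<omega> p = h \<omega>"
  proof (rule solution_measurable[of _ _ "V \<times> UNIV"])
    fix p :: "'v \<times> int" assume p: "p \<in> V \<times> UNIV"
    consider "snd p < s" | "p = (x, s)" | "s \<le> snd p" "p \<noteq> (x, s)" by fastforce
    then show "(\<exists>h\<in>info s (sources s) \<rightarrow>\<^sub>M count_space (D (fst p)). \<forall>\<omega>\<in>space M. do_obs x s a \<omega> p = h \<omega>) \<or>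
      (s \<le> snd p \<and> Some p \<in> sources s \<and>
       (\<forall>(z, l)\<in>lagged_parents G (fst p). (z, snd p - int l) \<in> V \<times> UNIV) \<and>
       (\<forall>\<omega>\<in>space M. do_obs x s a \<omega> p = f (fst p)
          (\<lambda>(z, l)\<in>lagged_parents G (fst p). do_obs x s a \<omega> (z, snd p - int l)) (noise p \<omega>)))"
    proof cases
      case 1
      then have "obs p \<in> info s (sources s) \<rightarrow>\<^sub>M count_space (D (fst p))"
        using p by (intro past_measurable_info) (auto simp: sources_def mem_Times_iff)
      then show ?thesis using do_obs_past[OF 1] by blast
    next
      case 2
      then show ?thesis
        using \<open>a \<in> D x\<close> by (auto simp: do_obs_intervened intro!: bexI[of _ "\<lambda>_. a"])
    next
      case 3
      then show ?thesis
        using p do_obs_structural[OF 3] by (auto simp: sources_def mem_Times_iff lagged_parents_V)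
    qed
  qed (use assms(3) in auto)
  then obtain h where h: "h \<in> info s (sources s) \<rightarrow>\<^sub>M count_space (D (fst p))"
    "\<And>\<omega>. \<omega> \<in> space M \<Longrightarrow> do_obs x s a \<omega> p = h \<omega>" by blast
  have "h \<in> M \<rightarrow>\<^sub>M count_space (D (fst p))"
    using h(1) sets_info_subset[of "sources s" s] by (auto simp: measurable_def)
  then show ?thesis
    using h(2) by (subst measurable_cong) auto
qed

lemma obs_in_domain: "p \<in> V \<times> UNIV \<Longrightarrow> \<omega> \<in> space M \<Longrightarrow> obs p \<omega> \<in> D (fst p)"
  using measurable_space[OF obs_measurable] by (cases p) auto

text \<open>A parent of a nondescendant of \<open>x\<close> is a nondescendant of \<open>x\<close>, so at time \<open>s\<close> the noise of descendants
  never enters.\<close>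

lemma nondescendant_measurable:
  assumes x: "x \<in> V" and p: "p \<in> V \<times> {..<s} \<union> (V - Desc x summary) \<times> {s}"
  defines "K \<equiv> insert None (Some ` ((V - Desc x summary) \<times> {s}))"
  shows "\<exists>h\<in>info s K \<rightarrow>\<^sub>M count_space (D (fst p)). \<forall>\<omega>\<in>solved. obs p \<omega> = h \<omega>"
proof (rule solution_measurable[OF _ _ _ _ p])
  let ?S = "V \<times> {..<s} \<union> (V - Desc x summary) \<times> {s}"
  fix p assume p: "p \<in> ?S"
  show "(\<exists>h\<in>info s K \<rightarrow>\<^sub>M count_space (D (fst p)). \<forall>\<omega>\<in>solved. obs p \<omega> = h \<omega>) \<or>
    (s \<le> snd p \<and> Some p \<in> K \<and>
     (\<forall>(z, l)\<in>lagged_parents G (fst p). (z, snd p - int l) \<in> ?S) \<and>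
     (\<forall>\<omega>\<in>solved. obs p \<omega> = f (fst p)
        (\<lambda>(z, l)\<in>lagged_parents G (fst p). obs (z, snd p - int l) \<omega>) (noise p \<omega>)))"
  proof (cases "snd p < s")
    case True
    then have "obs p \<in> info s K \<rightarrow>\<^sub>M count_space (D (fst p))"
      using p by (intro past_measurable_info) (auto simp: K_def)
    then show ?thesis by blast
  next
    case False
    then have p: "fst p \<in> V" "fst p \<notin> Desc x summary" "snd p = s" using p by auto
    moreover have "(z, s - int l) \<in> ?S" if "(z, l) \<in> lagged_parents G (fst p)" for z l
      using that p(2) Desc_summary_step[OF x] lagged_parents_V[OF that] by (cases "l = 0") auto
    ultimately show ?thesis
      using obs_structural[of _ p] by (cases p) (auto simp: K_def)
  qed
qed (auto simp: solved_def K_def sources_def)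

text \<open>The probabilistic core.  The sets \<open>A\<close> and \<open>B\<close> are closed under parents up to members of \<open>Z\<close> and
  \<open>(x, s)\<close>, so given \<open>Z\<close> they carry all noise that influences the treatment \<open>(x, s)\<close> and the value of
  \<open>(y, t)\<close> under \<open>do (x, s) = a\<close>, respectively.  Disjointness of \<open>A\<close> and \<open>B\<close> makes treatment and
  potential outcome conditionally independent given \<open>Z\<close>.\<close>

lemma valid_adjustment_by_separate_noise:
  assumes xy: "x \<in> V" "y \<in> V"
    and Z: "finite Z" "Z \<subseteq> V \<times> {..s}" "\<And>z. (z, s) \<in> Z \<Longrightarrow> z \<notin> Desc x summary"
    and A: "A \<subseteq> Desc x summary \<times> {s}" "(x, s) \<in> A"
      "\<And>w r z l. (w, r) \<in> A \<Longrightarrow> (z, l) \<in> lagged_parents G w \<Longrightarrow> (z, r - int l) \<in> A \<union> Z"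
    and B: "B \<subseteq> V \<times> {s..}" "\<And>w. (w, s) \<in> B \<Longrightarrow> w \<in> Desc x summary" "(y, t) \<in> B \<union> Z"
      "\<And>w r z l. (w, r) \<in> B \<Longrightarrow> (z, l) \<in> lagged_parents G w \<Longrightarrow> (z, r - int l) \<in> insert (x, s) (B \<union> Z)"
    and "A \<inter> B = {}"
  shows "valid_adjustment_set x s y t Z"
proof -
  have xZ: "(x, s) \<notin> Z"
    using Z(3)[of x] xy(1) by (auto simp: Desc_summary)
  have DescV: "Desc x summary \<subseteq> V" using Desc_summary_subset[OF xy(1)] .
  define K\<^sub>1 where "K\<^sub>1 = insert None (Some ` ((V - Desc x summary) \<times> {s}))"
  define K\<^sub>2 where "K\<^sub>2 = Some ` A"
  define K\<^sub>3 where "K\<^sub>3 = Some ` B"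
  have disj: "K\<^sub>1 \<inter> K\<^sub>2 = {}" "K\<^sub>1 \<inter> K\<^sub>3 = {}" "K\<^sub>2 \<inter> K\<^sub>3 = {}"
    using A(1) B(2) \<open>A \<inter> B = {}\<close> by (auto simp: K\<^sub>1_def K\<^sub>2_def K\<^sub>3_def)
  have K: "K\<^sub>1 \<subseteq> sources s" "K\<^sub>2 \<subseteq> sources s" "K\<^sub>3 \<subseteq> sources s"
    using A(1) B(1) DescV by (auto simp: K\<^sub>1_def K\<^sub>2_def K\<^sub>3_def sources_def)
  have "\<exists>h\<in>info s K\<^sub>1 \<rightarrow>\<^sub>M count_space (D (fst p)). \<forall>\<omega>\<in>solved. obs p \<omega> = h \<omega>" if "p \<in> Z" for p
    unfolding K\<^sub>1_def using that Z(2,3)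
    by (cases p) (intro nondescendant_measurable xy(1), auto simp: less_le)
  then have "\<forall>p\<in>Z. \<exists>h. h \<in> info s K\<^sub>1 \<rightarrow>\<^sub>M count_space (D (fst p)) \<and> (\<forall>\<omega>\<in>solved. obs p \<omega> = h \<omega>)"
    by blast
  from bchoice[OF this] obtain hZ where hZ: "\<And>p. p \<in> Z \<Longrightarrow> hZ p \<in> info s K\<^sub>1 \<rightarrow>\<^sub>M count_space (D (fst p))"
    "\<And>p \<omega>. p \<in> Z \<Longrightarrow> \<omega> \<in> solved \<Longrightarrow> obs p \<omega> = hZ p \<omega>" by blast
  show ?thesis
    unfolding valid_adjustment_set_def
  proof (intro ballI)
    fix a b assume ab: "a \<in> D x" "b \<in> D y"
    define ZE where "ZE z = {\<omega> \<in> space M. \<forall>p\<in>Z. obs p \<omega> = z p}" for z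
    define XE where "XE = {\<omega> \<in> space M. obs (x, s) \<omega> = a}"
    define YE where "YE = {\<omega> \<in> space M. obs (y, t) \<omega> = b}"
    define YE' where "YE' = {\<omega> \<in> space M. do_obs x s a \<omega> (y, t) = b}"
    let ?Z = "\<Pi>\<^sub>E (v, r)\<in>Z. D v"
    have ev: "XE \<in> events" "YE \<in> events" "YE' \<in> events"
    proof -
      have level: "{\<omega> \<in> space M. g \<omega> = c} \<in> events" if "g \<in> M \<rightarrow>\<^sub>M count_space C" "c \<in> C" for g C and c :: 'x
        using measurable_sets[OF that(1), of "{c}"] that(2) by (simp add: vimage_def Int_def conj_commute)
      show "XE \<in> events" unfolding XE_def using obs_measurable[OF xy(1)] ab(1) by (rule level)
      show "YE \<in> events" unfolding YE_def using obs_measurable[OF xy(2)] ab(2) by (rule level)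
      show "YE' \<in> events" unfolding YE'_def
        using do_obs_measurable[OF xy(1) ab(1), of "(y, t)" s] xy(2) ab(2) by (intro level) auto
    qed
    have level: "{\<omega> \<in> space M. g \<omega> = c} \<in> sets (info s K)"
      if "g \<in> info s K \<rightarrow>\<^sub>M count_space C" "c \<in> C" for g C K and c :: 'x
      using measurable_sets[OF that(1), of "{c}"] that(2) by (simp add: vimage_def Int_def conj_commute)
    have ZE_ev: "ZE z \<in> events" if z: "z \<in> ?Z" for z
    proof -
      have "{\<omega> \<in> space M. obs p \<omega> = z p} \<in> events" if "p \<in> Z" for p
        using measurable_sets[OF obs_measurable[of "fst p" "snd p"], of "{z p}"] that z Z(2)
        by (force simp: vimage_def Int_def conj_commute PiE_iff)
      then show ?thesis
        unfolding ZE_def by (intro sets.sets_Collect_finite_All Z(1)) auto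
    qed
    have cell: "prob (YE \<inter> XE \<inter> ZE z) / prob (XE \<inter> ZE z) * prob (ZE z) = prob (YE' \<inter> ZE z)"
      if z: "z \<in> ?Z" for z
    proof -
      \<comment> \<open>On \<open>E\<close> the adjustment set has the constant value \<open>z\<close>.\<close>
      define E where "E = {\<omega> \<in> solved. \<omega> \<in> ZE z}"
      have zD: "z p \<in> D (fst p)" if "p \<in> Z" for p
        using z that by (auto simp: PiE_iff split_beta)
      have "\<exists>h\<in>info s K\<^sub>2 \<rightarrow>\<^sub>M count_space (D (fst (x, s))). \<forall>\<omega>\<in>E. obs (x, s) \<omega> = h \<omega>"
      proof (rule solution_measurable[OF K(2), of "A \<union> Z"])
        fix p assume p: "p \<in> A \<union> Z"
        show "(\<exists>h\<in>info s K\<^sub>2 \<rightarrow>\<^sub>M count_space (D (fst p)). \<forall>\<omega>\<in>E. obs p \<omega> = h \<omega>) \<or>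
          (s \<le> snd p \<and> Some p \<in> K\<^sub>2 \<and>
           (\<forall>(z, l)\<in>lagged_parents G (fst p). (z, snd p - int l) \<in> A \<union> Z) \<and>
           (\<forall>\<omega>\<in>E. obs p \<omega> = f (fst p)
              (\<lambda>(z, l)\<in>lagged_parents G (fst p). obs (z, snd p - int l) \<omega>) (noise p \<omega>)))"
        proof (cases "p \<in> Z")
          case True
          then show ?thesis
            using zD[OF True] True
            by (intro disjI1 bexI[of _ "\<lambda>_. z p"]) (auto simp: E_def ZE_def)
        next
          case False
          with p have "p \<in> A" by simp
          then have p: "fst p \<in> Desc x summary" "snd p = s" "Some p \<in> K\<^sub>2"
            using A(1) by (auto simp: K\<^sub>2_def)
          have "\<forall>(z, l)\<in>lagged_parents G (fst p). (z, snd p - int l) \<in> A \<union> Z"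
            using A(3)[of "fst p" "snd p"] \<open>p \<in> A\<close> by auto
          moreover have "\<forall>\<omega>\<in>E. obs p \<omega> = f (fst p)
              (\<lambda>(z, l)\<in>lagged_parents G (fst p). obs (z, snd p - int l) \<omega>) (noise p \<omega>)"
            using p(1) DescV by (intro ballI obs_structural) (auto simp: E_def)
          ultimately show ?thesis using p by simp
        qed
      qed (use A(1,2) Z(2) DescV in \<open>auto simp: E_def solved_def\<close>)
      then obtain hX where "hX \<in> info s K\<^sub>2 \<rightarrow>\<^sub>M count_space (D (fst (x, s)))"
        "\<forall>\<omega>\<in>E. obs (x, s) \<omega> = hX \<omega>" by (rule bexE)
      note hX = this(1)[unfolded fst_conv] bspec[OF this(2)]
      have "\<exists>h\<in>info s K\<^sub>3 \<rightarrow>\<^sub>M count_space (D (fst (y, t))). \<forall>\<omega>\<in>E. do_obs x s a \<omega> (y, t) = h \<omega>"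
      proof (rule solution_measurable[OF K(3), of "insert (x, s) (B \<union> Z)"])
        fix p assume p: "p \<in> insert (x, s) (B \<union> Z)"
        consider "p = (x, s)" | "p \<in> Z" | "p \<in> B" "p \<noteq> (x, s)" using p by auto
        then show "(\<exists>h\<in>info s K\<^sub>3 \<rightarrow>\<^sub>M count_space (D (fst p)). \<forall>\<omega>\<in>E. do_obs x s a \<omega> p = h \<omega>) \<or>
          (s \<le> snd p \<and> Some p \<in> K\<^sub>3 \<and>
           (\<forall>(z, l)\<in>lagged_parents G (fst p). (z, snd p - int l) \<in> insert (x, s) (B \<union> Z)) \<and>
           (\<forall>\<omega>\<in>E. do_obs x s a \<omega> p = f (fst p)
              (\<lambda>(z, l)\<in>lagged_parents G (fst p). do_obs x s a \<omega> (z, snd p - int l)) (noise p \<omega>)))"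
        proof cases
          case 1
          then show ?thesis
            using ab(1) by (auto simp: do_obs_intervened intro!: bexI[of _ "\<lambda>_. a"])
        next
          case 2
          have "do_obs x s a \<omega> p = z p" if "\<omega> \<in> E" for \<omega>
          proof -
            have "do_obs x s a \<omega> p = obs p \<omega>"
            proof (cases "snd p < s")
              case False
              then have "snd p = s" "fst p \<in> V" using 2 Z(2) by auto
              then show ?thesis
                using Z(3)[of "fst p"] 2 that xy(1) by (intro do_obs_eq_obs) (auto simp: E_def)
            qed (rule do_obs_past)
            with that 2 show ?thesis by (auto simp: E_def ZE_def)
          qed
          then show ?thesis
            using zD[OF 2] by (intro disjI1 bexI[of _ "\<lambda>_. z p"]) auto
        next
          case 3
          then have p: "s \<le> snd p" "Some p \<in> K\<^sub>3"
            using B(1) by (auto simp: K\<^sub>3_def)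
          have "\<forall>(z, l)\<in>lagged_parents G (fst p). (z, snd p - int l) \<in> insert (x, s) (B \<union> Z)"
            using B(4)[of "fst p" "snd p"] 3(1) by auto
          moreover have "\<forall>\<omega>\<in>E. do_obs x s a \<omega> p = f (fst p)
              (\<lambda>(z, l)\<in>lagged_parents G (fst p). do_obs x s a \<omega> (z, snd p - int l)) (noise p \<omega>)"
            by (intro ballI do_obs_structural p(1) 3(2))
          ultimately show ?thesis using p by simp
        qed
      qed (use B(1,3) Z(2) xy in \<open>auto simp: E_def solved_def\<close>)
      then obtain hY where "hY \<in> info s K\<^sub>3 \<rightarrow>\<^sub>M count_space (D (fst (y, t)))"
        "\<forall>\<omega>\<in>E. do_obs x s a \<omega> (y, t) = hY \<omega>" by (rule bexE)
      note hY = this(1)[unfolded fst_conv] bspec[OF this(2)]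
      define P where "P = {\<omega> \<in> space M. \<forall>p\<in>Z. hZ p \<omega> = z p}"
      define Q where "Q = {\<omega> \<in> space M. hX \<omega> = a}"
      define R where "R = {\<omega> \<in> space M. hY \<omega> = b}"
      have "{\<omega> \<in> space M. hZ p \<omega> = z p} \<in> sets (info s K\<^sub>1)" if "p \<in> Z" for p
        using hZ(1)[OF that] zD[OF that] by (rule level)
      then have P: "P \<in> sets (info s K\<^sub>1)"
        unfolding P_def using sets.sets_Collect_finite_All[of Z "info s K\<^sub>1" "\<lambda>p \<omega>. hZ p \<omega> = z p"] Z(1)
        by simp
      have Q: "Q \<in> sets (info s K\<^sub>2)" unfolding Q_def using hX(1) ab(1) by (rule level)
      have R: "R \<in> sets (info s K\<^sub>3)" unfolding R_def using hY(1) ab(2) by (rule level)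
      have top: "space M \<in> sets (info s K)" for K using sets.top[of "info s K"] by simp
      note prod = prob_Int_info[OF disj K]
      have evPQR: "P \<in> events" "Q \<in> events" "R \<in> events"
        using P Q R K sets_info_subset by blast+
      \<comment> \<open>Up to a null set, the cell of \<open>z\<close> is cut out by three independent events \<open>P\<close>, \<open>Q\<close> and \<open>R\<close>.\<close>
      have memb: "\<omega> \<in> ZE z \<longleftrightarrow> \<omega> \<in> P" "\<omega> \<in> ZE z \<Longrightarrow> \<omega> \<in> XE \<longleftrightarrow> \<omega> \<in> Q"
        "\<omega> \<in> ZE z \<Longrightarrow> \<omega> \<in> YE' \<longleftrightarrow> \<omega> \<in> R" "\<omega> \<in> XE \<Longrightarrow> \<omega> \<in> YE \<longleftrightarrow> \<omega> \<in> YE'"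
        if "\<omega> \<in> solved" for \<omega>
        using that hZ(2)[OF _ that] hX(2)[of \<omega>] hY(2)[of \<omega>] do_obs_eq_obs[OF that xy(1), of "(y, t)" s a] xy(2)
        by (auto simp: ZE_def P_def Q_def R_def XE_def YE_def YE'_def E_def)
      have "prob (YE \<inter> XE \<inter> ZE z) = prob (P \<inter> Q \<inter> R)"
        using AE_solved by (intro finite_measure_eq_AE sets.Int ev ZE_ev[OF z] evPQR) (auto simp: memb)
      then have 1: "prob (YE \<inter> XE \<inter> ZE z) = prob P * prob Q * prob R"
        using prod[OF P Q R] by simp
      have "prob (XE \<inter> ZE z) = prob (P \<inter> Q \<inter> space M)"
        using AE_solved by (intro finite_measure_eq_AE sets.Int sets.top ev ZE_ev[OF z] evPQR)
            (auto simp: memb solved_def)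
      then have 2: "prob (XE \<inter> ZE z) = prob P * prob Q"
        using prod[OF P Q top] by (simp add: prob_space)
      have "prob (YE' \<inter> ZE z) = prob (P \<inter> space M \<inter> R)"
        using AE_solved by (intro finite_measure_eq_AE sets.Int sets.top ev ZE_ev[OF z] evPQR)
            (auto simp: memb solved_def)
      then have 3: "prob (YE' \<inter> ZE z) = prob P * prob R"
        using prod[OF P top R] by (simp add: prob_space)
      have "prob (ZE z) = prob P"
        using AE_solved by (intro finite_measure_eq_AE sets.Int ev ZE_ev[OF z] evPQR) (auto simp: memb)
      moreover have "prob (XE \<inter> ZE z) > 0"
      proof -
        have "0 < \<P>(\<omega> in M. \<forall>p\<in>insert (x, s) Z. obs p \<omega> = (z((x, s) := a)) p)"
        proof (rule positive)
          show "z((x, s) := a) \<in> (\<Pi>\<^sub>E (y, s)\<in>insert (x, s) Z. D y)"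
            using z ab(1) by (auto simp: PiE_iff extensional_def)
        qed (use Z xy in auto)
        also have "{\<omega> \<in> space M. \<forall>p\<in>insert (x, s) Z. obs p \<omega> = (z((x, s) := a)) p} = XE \<inter> ZE z"
          using xZ by (auto simp: XE_def ZE_def)
        finally show ?thesis .
      qed
      ultimately show ?thesis
        unfolding 1 2 3 by auto
    qed
    have "((\<lambda>z. prob (YE' \<inter> ZE z)) has_sum prob (\<Union>z\<in>?Z. YE' \<inter> ZE z)) ?Z"
    proof (rule measure_UN_has_sum)
      show "countable ?Z"
        using Z(1,2) by (intro countable_PiE) (auto intro!: countable_domain)
      show "YE' \<inter> ZE z \<in> events" if "z \<in> ?Z" for z
        using ev(3) ZE_ev[OF that] by blast
      show "disjoint_family_on (\<lambda>z. YE' \<inter> ZE z) ?Z"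
        unfolding disjoint_family_on_def
      proof (intro ballI impI)
        fix z z' assume zz: "z \<in> ?Z" "z' \<in> ?Z" "z \<noteq> z'"
        then obtain p where "p \<in> Z" "z p \<noteq> z' p" by (meson PiE_ext)
        then show "YE' \<inter> ZE z \<inter> (YE' \<inter> ZE z') = {}" by (force simp: ZE_def)
      qed
    qed
    also have "(\<Union>z\<in>?Z. YE' \<inter> ZE z) = YE'"
    proof -
      have "\<omega> \<in> ZE (\<lambda>p\<in>Z. obs p \<omega>)" "(\<lambda>p\<in>Z. obs p \<omega>) \<in> ?Z" if "\<omega> \<in> space M" for \<omega>
        using that Z(2) obs_in_domain[OF _ that] by (auto simp: ZE_def)
      then show ?thesis by (fastforce simp: YE'_def)
    qed
    finally have "((\<lambda>z. prob (YE \<inter> XE \<inter> ZE z) / prob (XE \<inter> ZE z) * prob (ZE z)) has_sum prob YE') ?Z"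
      by (subst has_sum_cong[OF cell])
    moreover have "YE \<inter> XE \<inter> ZE z = {\<omega> \<in> space M. obs (y, t) \<omega> = b \<and> obs (x, s) \<omega> = a \<and> (\<forall>p\<in>Z. obs p \<omega> = z p)}"
      "XE \<inter> ZE z = {\<omega> \<in> space M. obs (x, s) \<omega> = a \<and> (\<forall>p\<in>Z. obs p \<omega> = z p)}" for z
      by (auto simp: YE_def XE_def ZE_def)
    ultimately show "((\<lambda>z. \<P>(\<omega> in M. obs (y, t) \<omega> = b \<bar> obs (x, s) \<omega> = a \<and> (\<forall>p\<in>Z. obs p \<omega> = z p))
        * \<P>(\<omega> in M. \<forall>p\<in>Z. obs p \<omega> = z p)) has_sum do_prob x s a y t b) ?Z"
      by (simp add: cond_prob_def do_prob_def YE'_def ZE_def)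
  qed
qed

end

section \<open>Validity of the reduced adjustment set\<close>

theorem proposition2:
  fixes Gs :: "'v pair_pre_digraph" and X Y :: 'v and \<gamma> gmax :: nat and t :: int
    and G :: "('v \<times> int) pair_pre_digraph"
    and M :: "'w measure" and D :: "'v \<Rightarrow> 'x set" and N :: "'v \<Rightarrow> 'u measure"
    and noise :: "'v \<times> int \<Rightarrow> 'w \<Rightarrow> 'u"
    and f :: "'v \<Rightarrow> ('v \<times> nat \<Rightarrow> 'x) \<Rightarrow> 'u \<Rightarrow> 'x"
    and obs :: "'v \<times> int \<Rightarrow> 'w \<Rightarrow> 'x"
  assumes scg: "summary_causal_graph gmax Gs"
    and XY: "X \<in> pverts Gs" "Y \<in> pverts Gs" "X \<noteq> Y"
    and cond: "X \<notin> Anc Y Gs \<or>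
      X \<in> Anc Y Gs \<and>
      \<not> (\<gamma> \<noteq> 0 \<and> Cycles_gt X (pre_digraph.del_vert Gs Y) \<noteq> {}) \<and>
      \<not> (\<exists>\<pi>. backdoor_path Gs X \<pi> Y \<and> sigma_active Gs \<pi> \<and>
             set (butlast (tl \<pi>)) \<subseteq> Desc X Gs \<and>
             (length \<pi> > 2 \<or>
              length \<pi> = 2 \<and> \<gamma> \<noteq> 1 \<or>
              length \<pi> = 2 \<and> \<gamma> = 1 \<and> Cycles Y Gs - {{(X, Y), (Y, X)}} \<noteq> {}))"
    and candidate: "G \<in> candidate_ftcgs gmax Gs"
    and model: "dscm (pverts Gs) gmax G M D N noise f obs"
  shows "dscm.valid_adjustment_set G M D noise f obs X (t - int \<gamma>) Y t
           (reduced_adjustment_set gmax Gs X Y \<gamma> t)"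
proof -
  interpret dscm "pverts Gs" gmax G M D N noise f obs by (rule model)
  have Gs: "summary = Gs"
    using candidate by (simp add: candidate_ftcgs_def)
  define s where "s = t - int \<gamma>"
  define R where "R = {(p, q) \<in> parcs G. p \<noteq> (X, s)}"
  define Z where "Z = reduced_adjustment_set gmax Gs X Y \<gamma> t"
  define A where "A = {p \<in> Desc X Gs \<times> {s}. (p, (X, s)) \<in> (parcs G)\<^sup>*}"
  define B where "B = {p \<in> pverts Gs \<times> {s..}. p \<noteq> (X, s) \<and> (snd p = s \<longrightarrow> fst p \<in> Desc X Gs) \<and>
    (p, (Y, t)) \<in> R\<^sup>*}"
  have Anc: "z \<in> Anc x Gs \<longleftrightarrow> (z, x) \<in> (parcs Gs)\<^sup>*" if "z \<in> pverts Gs" for z x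
    using Anc_summary[OF that] by (simp add: Gs)
  have walk_Anc: "fst p \<in> Anc (fst q) Gs" if "(p, q) \<in> (parcs G)\<^sup>*" "fst p \<in> pverts Gs" for p q
    using walk_summary(1)[OF that(1)] that(2) by (simp add: Anc Gs)
  have R_sub: "R\<^sup>* \<subseteq> (parcs G)\<^sup>*" unfolding R_def by (rule rtrancl_mono) auto
  have XD: "X \<in> Desc X Gs" using XY(1) Desc_summary[of X X] by (simp add: Gs)
  \<comment> \<open>The two windows of the adjustment set differ only in the descendants of \<open>X\<close> at time \<open>s\<close> itself.\<close>
  have Z_mem: "(z, r) \<in> Z \<longleftrightarrow> z \<in> Anc X Gs \<union> Anc Y Gs \<and> z \<in> pverts Gs \<and>
      s - int gmax \<le> r \<and> r \<le> s \<and> (r = s \<longrightarrow> z \<notin> Desc X Gs)" for z r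
  proof -
    have "Desc X Gs \<subseteq> pverts Gs" using Desc_summary_subset[OF XY(1)] by (simp add: Gs)
    moreover have "\<exists>l. r = s - int l \<and> 1 \<le> l \<and> l \<le> gmax" if "s - int gmax \<le> r" "r < s"
      using that by (intro exI[of _ "nat (s - r)"]) auto
    moreover have "\<exists>l. r = s - int l \<and> l \<le> gmax" if "s - int gmax \<le> r" "r \<le> s"
      using that by (intro exI[of _ "nat (s - r)"]) auto
    ultimately show ?thesis
      unfolding Z_def reduced_adjustment_set_def adjustment_set_def s_def[symmetric]
      by (cases "r < s") auto
  qed
  have "valid_adjustment_set X s Y t Z"
  proof (rule valid_adjustment_by_separate_noise[where A = A and B = B, OF XY(1,2)])
    show "finite Z"
    proof (rule finite_subset)
      show "Z \<subseteq> pverts Gs \<times> {s - int gmax..s}" by (auto simp: Z_mem)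
      show "finite (pverts Gs \<times> {s - int gmax..s})" using finite_series by simp
    qed
    show "Z \<subseteq> pverts Gs \<times> {..s}" by (auto simp: Z_mem)
    show "z \<notin> Desc X summary" if "(z, s) \<in> Z" for z
      using that by (simp add: Z_mem Gs)
    show "A \<subseteq> Desc X summary \<times> {s}" by (auto simp: A_def Gs)
    show "(X, s) \<in> A" using XD by (simp add: A_def)
    show "(z, r - int l) \<in> A \<union> Z" if wr: "(w, r) \<in> A" and zl: "(z, l) \<in> lagged_parents G w" for w r z l
    proof -
      have r: "r = s" and walk: "((w, s), (X, s)) \<in> (parcs G)\<^sup>*" using wr by (auto simp: A_def)
      from lagged_parents_arc[OF zl, of s] walk
      have walk': "((z, s - int l), (X, s)) \<in> (parcs G)\<^sup>*" by (rule converse_rtrancl_into_rtrancl)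
      have "z \<in> Anc X Gs" using walk_Anc[OF walk'] lagged_parents_V[OF zl] by simp
      then show ?thesis
        using walk' lagged_parents_V[OF zl] by (cases "l = 0") (auto simp: A_def Z_mem r)
    qed
    show "B \<subseteq> pverts Gs \<times> {s..}" by (auto simp: B_def)
    show "w \<in> Desc X summary" if "(w, s) \<in> B" for w using that by (simp add: B_def Gs)
    show "(Y, t) \<in> B \<union> Z"
      using XY walk_Anc[of "(Y, t)" "(Y, t)"] by (auto simp: B_def Z_mem s_def)
    show "(z, r - int l) \<in> insert (X, s) (B \<union> Z)"
      if wr: "(w, r) \<in> B" and zl: "(z, l) \<in> lagged_parents G w" for w r z l
    proof (cases "(z, r - int l) = (X, s)")
      case False
      have r: "s \<le> r" and walk: "((w, r), (Y, t)) \<in> R\<^sup>*" using wr by (auto simp: B_def)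
      have "((z, r - int l), (w, r)) \<in> R"
        using lagged_parents_arc[OF zl, of r] False by (auto simp: R_def)
      from this walk have walk': "((z, r - int l), (Y, t)) \<in> R\<^sup>*" by (rule converse_rtrancl_into_rtrancl)
      have "z \<in> Anc Y Gs"
        using walk_Anc[OF subsetD[OF R_sub walk']] lagged_parents_V[OF zl] by simp
      then show ?thesis
        using False r walk' lagged_parents_V[OF zl]
        by (cases "r - int l < s \<or> r - int l = s \<and> z \<notin> Desc X Gs") (auto simp: B_def Z_mem)
    qed simp
    show "A \<inter> B = {}"
    proof (rule ccontr)
      assume "A \<inter> B \<noteq> {}"
      then obtain w where w: "w \<in> Desc X Gs" "w \<noteq> X" "w \<in> pverts Gs"
        and wX: "((w, s), (X, s)) \<in> (parcs G)\<^sup>*" and wY: "((w, s), (Y, t)) \<in> R\<^sup>*"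
        by (auto simp: A_def B_def)
      have "(w, Y) \<in> (parcs Gs)\<^sup>*"
        using walk_summary(1)[OF subsetD[OF R_sub wY]] by (simp add: Gs)
      then have "(X, Y) \<in> (parcs Gs)\<^sup>*"
        using w(1) Desc_summary[of X w] XY(1) by (simp add: Gs)
      then have "X \<in> Anc Y Gs" by (simp add: Anc XY(1))
      with cond have no_cycle: "\<gamma> \<noteq> 0 \<Longrightarrow> Cycles_gt X (pre_digraph.del_vert Gs Y) = {}"
        and no_path: "\<not> (\<exists>\<pi>. backdoor_path Gs X \<pi> Y \<and> sigma_active Gs \<pi> \<and>
             set (butlast (tl \<pi>)) \<subseteq> Desc X Gs \<and>
             (length \<pi> > 2 \<or> length \<pi> = 2 \<and> \<gamma> \<noteq> 1 \<or>
              length \<pi> = 2 \<and> \<gamma> = 1 \<and> Cycles Y Gs - {{(X, Y), (Y, X)}} \<noteq> {}))"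
        by blast+
      have inner: "set (butlast (tl \<pi>)) \<subseteq> set \<pi>" for \<pi> :: "'v list"
        by (cases \<pi>) (auto dest: in_set_butlastD)
      show False
      proof (cases "\<gamma> = 0")
        case True
        then have "t = s" by (simp add: s_def)
        obtain \<pi> where \<pi>: "backdoor_path Gs X \<pi> Y" "sigma_active Gs \<pi>" "set \<pi> \<subseteq> Desc X Gs" "2 \<le> length \<pi>"
          using contemporaneous_fork_backdoor_path[unfolded Gs, OF XY w(1) wX wY[unfolded R_def \<open>t = s\<close>]] .
        have "length \<pi> > 2 \<or> length \<pi> = 2 \<and> \<gamma> \<noteq> 1" using \<pi>(4) True by auto
        with no_path \<pi>(1,2) order_trans[OF inner \<pi>(3)] show False by blast
      next
        case False
        have t: "t = s + int \<gamma>" by (simp add: s_def)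
        obtain \<pi> where \<pi>: "backdoor_path Gs X \<pi> Y" "sigma_active Gs \<pi>" "set \<pi> \<subseteq> Desc X Gs"
          "length \<pi> > 2 \<or> length \<pi> = 2 \<and> \<gamma> \<noteq> 1 \<or>
           length \<pi> = 2 \<and> \<gamma> = 1 \<and> Cycles Y Gs - {{(X, Y), (Y, X)}} \<noteq> {}"
          using lagged_fork_backdoor_path[unfolded Gs, OF XY False no_cycle[OF False] w(1,2) wX
              wY[unfolded R_def t]] by blast
        with no_path order_trans[OF inner \<pi>(3)] show False by blast
      qed
    qed
  qed
  then show ?thesis unfolding Z_def s_def .
qed

end
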